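(* Let $\gamma\ge1$, let $p,s\in\mathcal P^\gamma$ satisfy $p(x)<s(x)$ for all $x\in[0;2\pi]$, put $\alpha=1/\underline p-1/\overline s$, and let $(\psi;\beta)\in\Upsilon_{\alpha,n}$. Then there exists a positive constant $C_{p,s}$ independent of $n$ such that for all $n\in\mathbb N$ $$\mathcal E\big(L^{\psi}_{\beta,p(\cdot)};\hat Z_n\big)_{s(\cdot)}\le C_{p,s}\,n^{\alpha}\,\nu(n),\qquad \nu(n)=\sup_{k\ge n}|\psi(k)|.$$
   Context: Variable exponent spaces. For a $2\pi$-periodic measurable essentially bounded function $p=p(x)$, $L^{p(\cdot)}$ is the space of measurable $2\pi$-periodic functions $f$ with $\int_{-\pi}^{\pi}|f(x)|^{p(x)}\,dx<\infty$, with norm $$\|f\|_{p(\cdot)}=\inf\Big\{\alpha>0:\ \int_{-\pi}^{\pi}\Big|\frac{f(x)}{\alpha}\Big|^{p(x)}dx\le 1\Big\}.$$ $\underline p=\operatorname{ess\,inf}_x|p(x)|$, $\overline p=\operatorname{ess\,sup}_x|p(x)|$, and similarly for $s$. $L$ is the space of $2\pi$-periodic functions integrable over a period. The function $p$ satisfies the Dini-Lipschitz condition of order $\gamma$ if there is a constant $K$ with $\omega(p;\delta)\big(\ln\frac1\delta\big)^{\gamma}\le K$ for all $0<\delta<1$, where $\omega(p;\delta)=\sup\{|p(x_1)-p(x_2)|:\ x_1,x_2\in[-\pi;\pi],\ |x_1-x_2|\le\delta\}$. For $\gamma\ge1$, $\mathcal P^\gamma$ is the set of $2\pi$-periodic exponents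 $p=p(x)>1$ satisfying the Dini-Lipschitz condition of order $\gamma$. $(\psi;\beta)$-derivatives. Let $\psi:\mathbb N\to\mathbb R$ be a function with $\psi(k)\neq0$ for all $k$, and let $\beta\in\mathbb R$. For $f\in L$ let $a_k(f),b_k(f)$ be its Fourier coefficients, and write its Fourier series as $S[f]=\frac{a_0(f)}2+\sum_{k=1}^\infty(a_k(f)\cos kx+b_k(f)\sin kx)\equiv\sum_{k=0}^\infty A_k(f;x)$. If the series $$\sum_{k=1}^\infty\frac1{\psi(k)}\Big(a_k(f)\cos\big(kx+\tfrac{\beta\pi}2\big)+b_k(f)\sin\big(kx+\tfrac{\beta\pi}2\big)\Big)$$ is the Fourier series of some function from $L$, this function is denoted $f^\psi_\beta$ and called the $(\psi;\beta)$-derivative of $f$; the set of all such $f$ is $L^\psi_\beta$. The class $L^\psi_{\beta,p(\cdot)}$ is the set of $f\in L^\psi_\beta$ such that $f^\psi_\beta\in L^{p(\cdot)}$ and $\|f^\psi_\beta\|_{p(\cdot)}\le1$. Analogue of Zigmund's sums. For $n\in\mathbb N$, $$\hat Z_n(f;x)=\frac{a_0(f)}2+\sum_{k=1}^{n-1}\Big(1-\frac{\psi(n)}{\psi(k)}\Big)A_k(f;x),$$ and $\mathcal E(L^\psi_{\beta,p(\cdot)};\hat Z_n)_{s(\cdot)}=\sup_{f\in L^\psi_{\beta,p(\cdot)}}\|f-\hat Z_n(f)\|_{s(\cdot)}$. The class $\Upsilon_{\alpha,n}$. Let $\nu(n)=\sup_{k\ge n}|\psi(k)|$. For $\alpha\ge0$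 and $n\in\mathbb N$ put $$\mu_{n,\alpha}(k)=\begin{cases}k^\alpha\psi(n)\cos\frac{\beta\pi}2,&1\le k\le n-1,\\ k^\alpha\psi(k)\cos\frac{\beta\pi}2,&k\ge n,\end{cases}\qquad \tilde\mu_{n,\alpha}(k)=\begin{cases}k^\alpha\psi(n)\sin\frac{\beta\pi}2,&1\le k\le n-1,\\ k^\alpha\psi(k)\sin\frac{\beta\pi}2,&k\ge n.\end{cases}$$ $(\psi;\beta)\in\Upsilon_{\alpha,n}$ means that there are positive constants $C,K$ independent of $n$ such that for every positive integer $n$ $$\sup_k|\mu_{n,\alpha}(k)|\le C\,\nu(n)\,n^\alpha<K,\qquad \sup_{m\in\mathbb N}\sum_{k=2^m}^{2^{m+1}}|\mu_{n,\alpha}(k+1)-\mu_{n,\alpha}(k)|\le C\,\nu(n)\,n^\alpha<K,$$ and the same two conditions hold with $\tilde\mu_{n,\alpha}$ in place of $\mu_{n,\alpha}$. *)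

theory Defs
  imports "HOL-Analysis.Analysis" "HOL-Probability.Essential_Supremum"
begin

text \<open>
  Conventions: \<open>2\<pi>\<close>-periodic functions are functions on the whole real line that
  are periodic pointwise; measurability and integrals are Lebesgue.  Natural
  number indices start at \<open>1\<close>, so the value of \<open>\<psi>\<close> at \<open>0\<close> is irrelevant
  everywhere below.  Norms, moduli of continuity and suprema that may be infinite take
  values in \<open>ennreal\<close>.
\<close>

definition periodic_2pi :: "(real \<Rightarrow> real) \<Rightarrow> bool" where
  "periodic_2pi f \<longleftrightarrow> (\<forall>x. f (x + 2 * pi) = f x)"

definition Lper :: "(real \<Rightarrow> real) set" where
  "Lper = {f. periodic_2pi f \<and> set_integrable lebesgue {-pi..pi} f}"

definition exponent :: "(real \<Rightarrow> real) \<Rightarrow> bool" where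
  "exponent p \<longleftrightarrow> periodic_2pi p \<and> p \<in> borel_measurable lebesgue
     \<and> (\<exists>B. AE x in lebesgue. \<bar>p x\<bar> \<le> B)"

text \<open>Essential bounds are taken in \<open>ereal\<close>; for an exponent they are finite, so the
  conversion back to \<open>real\<close> loses nothing.\<close>

definition exp_lower :: "(real \<Rightarrow> real) \<Rightarrow> real" where
  "exp_lower p = real_of_ereal (- esssup lebesgue (\<lambda>x. - ereal \<bar>p x\<bar>))"

definition exp_upper :: "(real \<Rightarrow> real) \<Rightarrow> real" where
  "exp_upper p = real_of_ereal (esssup lebesgue (\<lambda>x. ereal \<bar>p x\<bar>))"

definition var_modular :: "(real \<Rightarrow> real) \<Rightarrow> (real \<Rightarrow> real) \<Rightarrow> ennreal" where
  "var_modular p f =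
     (\<integral>\<^sup>+ x. ennreal (\<bar>f x\<bar> powr p x) * indicator {-pi..pi} x \<partial>lebesgue)"

definition Lvar :: "(real \<Rightarrow> real) \<Rightarrow> (real \<Rightarrow> real) set" where
  "Lvar p = {f. periodic_2pi f \<and> f \<in> borel_measurable lebesgue \<and> var_modular p f < \<infinity>}"

text \<open>The infimum over the empty set is \<open>\<infinity>\<close>, so a function outside the space has
  infinite norm.\<close>

definition var_norm :: "(real \<Rightarrow> real) \<Rightarrow> (real \<Rightarrow> real) \<Rightarrow> ennreal" where
  "var_norm p f =
     (INF a\<in>{a::real. a > 0 \<and> var_modular p (\<lambda>x. f x / a) \<le> 1}. ennreal a)"

definition modulus_cont :: "(real \<Rightarrow> real) \<Rightarrow> real \<Rightarrow> ennreal" where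
  "modulus_cont p \<delta> =
     (SUP (x1, x2)\<in>{(x1, x2). x1 \<in> {-pi..pi} \<and> x2 \<in> {-pi..pi} \<and> \<bar>x1 - x2\<bar> \<le> \<delta>}.
        ennreal \<bar>p x1 - p x2\<bar>)"

definition dini_lipschitz :: "real \<Rightarrow> (real \<Rightarrow> real) \<Rightarrow> bool" where
  "dini_lipschitz \<gamma> p \<longleftrightarrow>
     (\<exists>K::real. \<forall>\<delta>. 0 < \<delta> \<and> \<delta> < 1 \<longrightarrow>
        modulus_cont p \<delta> * ennreal (ln (1 / \<delta>) powr \<gamma>) \<le> ennreal K)"

definition DL_exponents :: "real \<Rightarrow> (real \<Rightarrow> real) set" where
  "DL_exponents \<gamma> = {p. exponent p \<and> (\<forall>x. p x > 1) \<and> dini_lipschitz \<gamma> p}"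

definition fourier_a :: "(real \<Rightarrow> real) \<Rightarrow> nat \<Rightarrow> real" where
  "fourier_a f k = (1 / pi) * (LINT x:{-pi..pi}|lebesgue. f x * cos (real k * x))"

definition fourier_b :: "(real \<Rightarrow> real) \<Rightarrow> nat \<Rightarrow> real" where
  "fourier_b f k = (1 / pi) * (LINT x:{-pi..pi}|lebesgue. f x * sin (real k * x))"

definition fourier_A :: "nat \<Rightarrow> (real \<Rightarrow> real) \<Rightarrow> real \<Rightarrow> real" where
  "fourier_A k f x =
     (if k = 0 then fourier_a f 0 / 2
      else fourier_a f k * cos (real k * x) + fourier_b f k * sin (real k * x))"

text \<open>That a trigonometric series is the Fourier series of \<open>g\<close> means that its terms are
  the terms of the Fourier series of \<open>g\<close>; the zeroth term here is \<open>0\<close>.  Since \<open>g\<close> is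
  determined only up to null sets, the derivative is rendered as a relation between
  \<open>f\<close> and \<open>g\<close>.\<close>

definition is_psi_beta_deriv ::
  "(nat \<Rightarrow> real) \<Rightarrow> real \<Rightarrow> (real \<Rightarrow> real) \<Rightarrow> (real \<Rightarrow> real) \<Rightarrow> bool" where
  "is_psi_beta_deriv \<psi> \<beta> f g \<longleftrightarrow>
     g \<in> Lper \<and> (\<forall>x. fourier_A 0 g x = 0) \<and>
     (\<forall>k\<ge>1. \<forall>x. fourier_A k g x =
        1 / \<psi> k * (fourier_a f k * cos (real k * x + \<beta> * pi / 2)
                 + fourier_b f k * sin (real k * x + \<beta> * pi / 2)))"

definition L_psi_beta :: "(nat \<Rightarrow> real) \<Rightarrow> real \<Rightarrow> (real \<Rightarrow> real) set" where
  "L_psi_beta \<psi> \<beta> = {f \<in> Lper. \<exists>g. is_psi_beta_deriv \<psi> \<beta> f g}"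

definition L_psi_beta_p ::
  "(nat \<Rightarrow> real) \<Rightarrow> real \<Rightarrow> (real \<Rightarrow> real) \<Rightarrow> (real \<Rightarrow> real) set" where
  "L_psi_beta_p \<psi> \<beta> p =
     {f \<in> L_psi_beta \<psi> \<beta>. \<exists>g. is_psi_beta_deriv \<psi> \<beta> f g \<and> g \<in> Lvar p \<and> var_norm p g \<le> 1}"

definition Zhat :: "(nat \<Rightarrow> real) \<Rightarrow> nat \<Rightarrow> (real \<Rightarrow> real) \<Rightarrow> real \<Rightarrow> real" where
  "Zhat \<psi> n f x =
     fourier_a f 0 / 2 + (\<Sum>k\<in>{1..<n}. (1 - \<psi> n / \<psi> k) * fourier_A k f x)"

definition approx_error ::
  "(nat \<Rightarrow> real) \<Rightarrow> real \<Rightarrow> (real \<Rightarrow> real) \<Rightarrow> nat \<Rightarrow> (real \<Rightarrow> real) \<Rightarrow> ennreal" where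
  "approx_error \<psi> \<beta> p n s =
     (SUP f\<in>L_psi_beta_p \<psi> \<beta> p. var_norm s (\<lambda>x. f x - Zhat \<psi> n f x))"

definition nu :: "(nat \<Rightarrow> real) \<Rightarrow> nat \<Rightarrow> ennreal" where
  "nu \<psi> n = (SUP k\<in>{n..}. ennreal \<bar>\<psi> k\<bar>)"

definition mu :: "(nat \<Rightarrow> real) \<Rightarrow> real \<Rightarrow> nat \<Rightarrow> real \<Rightarrow> nat \<Rightarrow> real" where
  "mu \<psi> \<beta> n \<alpha> k =
     (if k < n then real k powr \<alpha> * \<psi> n * cos (\<beta> * pi / 2)
      else real k powr \<alpha> * \<psi> k * cos (\<beta> * pi / 2))"

definition mu_tilde :: "(nat \<Rightarrow> real) \<Rightarrow> real \<Rightarrow> nat \<Rightarrow> real \<Rightarrow> nat \<Rightarrow> real" where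
  "mu_tilde \<psi> \<beta> n \<alpha> k =
     (if k < n then real k powr \<alpha> * \<psi> n * sin (\<beta> * pi / 2)
      else real k powr \<alpha> * \<psi> k * sin (\<beta> * pi / 2))"

definition seq_sup :: "(nat \<Rightarrow> real) \<Rightarrow> ennreal" where
  "seq_sup m = (SUP k\<in>{1..}. ennreal \<bar>m k\<bar>)"

definition dyadic_variation :: "(nat \<Rightarrow> real) \<Rightarrow> ennreal" where
  "dyadic_variation m =
     (SUP j\<in>{1..}. ennreal (\<Sum>k\<in>{2 ^ j..2 ^ (j + 1)}. \<bar>m (k + 1) - m k\<bar>))"

definition Upsilon :: "real \<Rightarrow> ((nat \<Rightarrow> real) \<times> real) set" where
  "Upsilon \<alpha> =
     {(\<psi>, \<beta>). \<exists>C K :: real. C > 0 \<and> K > 0 \<and>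
        (\<forall>n\<ge>1.
           seq_sup (mu \<psi> \<beta> n \<alpha>) \<le> ennreal C * nu \<psi> n * ennreal (real n powr \<alpha>) \<and>
           dyadic_variation (mu \<psi> \<beta> n \<alpha>) \<le> ennreal C * nu \<psi> n * ennreal (real n powr \<alpha>) \<and>
           seq_sup (mu_tilde \<psi> \<beta> n \<alpha>) \<le> ennreal C * nu \<psi> n * ennreal (real n powr \<alpha>) \<and>
           dyadic_variation (mu_tilde \<psi> \<beta> n \<alpha>) \<le> ennreal C * nu \<psi> n * ennreal (real n powr \<alpha>) \<and>
           ennreal C * nu \<psi> n * ennreal (real n powr \<alpha>) < ennreal K)}"

end

theory Submission
  imports Defs "HOL-Real_Asymp.Real_Asymp"
begin

text \<open>
  On a period the space with variable exponent \<open>p\<close> embeds into the Lebesgue space with constant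
  exponent \<open>inf p\<close>, and the one with constant exponent \<open>sup s\<close> embeds into the space with
  variable exponent \<open>s\<close>; since \<open>\<alpha> = 1 / inf p - 1 / sup s\<close>, constant exponents suffice.  The deviation
  \<open>f - Zhat \<psi> n f\<close> arises from the derivative \<open>g\<close> by the multiplier \<open>\<psi> n\<close> (\<open>k < n\<close>), \<open>\<psi> k\<close>
  (\<open>k \<ge> n\<close>) and a phase shift.  The hypothesis says that this multiplier is \<open>k\<close> to the power
  \<open>-\<alpha>\<close> times a bounded sequence of bounded dyadic variation, so Abel summation bounds all partial
  sums of its kernel by a constant times \<open>\<bar>t\<bar>\<close> to the power \<open>\<alpha> - 1\<close>.  No multiplier
  theorem is needed: the Hardy-Littlewood-Sobolev inequality applies directly.  It is used in
  bilinear form, tested against trigonometric polynomials, for which the partial sums are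
  eventually exact; density of these polynomials and duality give the norm bound.
\<close>

section \<open>The bilinear Hardy-Littlewood-Sobolev inequality\<close>

text \<open>Write \<open>p0\<close> for inf \<open>p\<close>, \<open>s1\<close> for sup
  \<open>s\<close> and \<open>r\<close> for the exponent conjugate to \<open>s1\<close>. Then
  \<open>1 / p0 + 1 / r = 1 + \<alpha>\<close> is exactly the scaling balance of a kernel of size
  \<open>|t|\<close> to the power \<open>\<alpha> - 1\<close>, while \<open>1 < p0 < s1\<close>
  gives \<open>0 < \<alpha> < 1\<close> and \<open>r > 1\<close>, away from the endpoints where the
  bilinear inequality fails. The obstacle is convergence: \<open>f\<close> is merely integrable, so
  neither its Fourier series nor the kernel series can be summed pointwise or in norm. Hence no
  limit kernel is formed. All estimates are uniform in the number \<open>N\<close> of terms, and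
  \<open>N\<close> is chosen after the test polynomial. The phase is never split off: the conditions
  on \<open>mu\<close> and \<open>mu_tilde\<close> are merged into one condition on a real sequence,
  and the phase stays inside the cosines of the kernel. The dependence on \<open>n\<close> is
  carried by a single number \<open>M\<close>, a constant times \<open>nu \<psi> n\<close> times
  \<open>n\<close> to the power \<open>\<alpha>\<close>, which enters every estimate
  linearly.\<close>

lemma nn_integral_even_le:
  fixes F :: "real \<Rightarrow> ennreal"
  assumes [measurable]: "F \<in> borel_measurable borel"
  shows "(\<integral>\<^sup>+t. F \<bar>t\<bar> \<partial>lborel) \<le> 2 * (\<integral>\<^sup>+t. F t * indicator {0..} t \<partial>lborel)"
proof -
  have "(\<integral>\<^sup>+t. F \<bar>t\<bar> \<partial>lborel) \<le> (\<integral>\<^sup>+t. F t * indicator {0..} t + F (- t) * indicator {0..} (- t) \<partial>lborel)"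
    by (intro nn_integral_mono) (auto simp: indicator_def)
  also have "\<dots> = (\<integral>\<^sup>+t. F t * indicator {0..} t \<partial>lborel) + (\<integral>\<^sup>+t. F (- t) * indicator {0..} (- t) \<partial>lborel)"
    by (rule nn_integral_add) auto
  also have "(\<integral>\<^sup>+t. F (- t) * indicator {0..} (- t) \<partial>lborel) = (\<integral>\<^sup>+t. F t * indicator {0..} t \<partial>lborel)"
    using nn_integral_real_affine[of "\<lambda>t. F t * indicator {0..} t" "-1" 0] by simp
  finally show ?thesis by (simp add: mult_2)
qed

lemma nn_integral_powr_from_0:
  fixes a c :: real
  assumes "a > -1" "c \<ge> 0"
  shows "(\<integral>\<^sup>+t. ennreal (t powr a) * indicator {0..c} t \<partial>lborel) = ennreal (c powr (a + 1) / (a + 1))"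
proof -
  have "((\<lambda>t. if t \<in> {0..c} then t powr a else 0) has_integral (c powr (a + 1) / (a + 1))) UNIV"
    using has_integral_powr_from_0[OF assms] by (simp only: has_integral_restrict_UNIV)
  then have "(\<integral>\<^sup>+t. ennreal (if t \<in> {0..c} then t powr a else 0) \<partial>lborel) = ennreal (c powr (a + 1) / (a + 1))"
    by (intro nn_integral_has_integral_lborel) auto
  moreover have "(\<integral>\<^sup>+t. ennreal (t powr a) * indicator {0..c} t \<partial>lborel)
      = (\<integral>\<^sup>+t. ennreal (if t \<in> {0..c} then t powr a else 0) \<partial>lborel)"
    by (intro nn_integral_cong) (auto simp: indicator_def)
  ultimately show ?thesis by simp
qed

lemma nn_integral_powr_to_inf:
  fixes a c :: real
  assumes "a < -1" "c > 0"
  shows "(\<integral>\<^sup>+t. ennreal (t powr a) * indicator {c..} t \<partial>lborel) = ennreal (- (c powr (a + 1)) / (a + 1))"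
proof -
  have "((\<lambda>t. if t \<in> {c..} then t powr a else 0) has_integral (- (c powr (a + 1)) / (a + 1))) UNIV"
    using has_integral_powr_to_inf[OF assms] by (simp only: has_integral_restrict_UNIV)
  then have "(\<integral>\<^sup>+t. ennreal (if t \<in> {c..} then t powr a else 0) \<partial>lborel) = ennreal (- (c powr (a + 1)) / (a + 1))"
    by (intro nn_integral_has_integral_lborel) auto
  moreover have "(\<integral>\<^sup>+t. ennreal (t powr a) * indicator {c..} t \<partial>lborel)
      = (\<integral>\<^sup>+t. ennreal (if t \<in> {c..} then t powr a else 0) \<partial>lborel)"
    by (intro nn_integral_cong) (auto simp: indicator_def)
  ultimately show ?thesis by simp
qed

text \<open>A function of unit norm and height \<open>B\<close> lives on the length scale
  \<open>B powr (- r)\<close>. Closer to \<open>z\<close> than that, the height bound is used;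
  farther away, Young's inequality, where \<open>\<alpha> * r < 1\<close> makes the conjugate power
  of the kernel integrable at infinity. Both parts yield the same power of \<open>B\<close>.\<close>

lemma riesz_potential_truncated:
  fixes \<alpha> r :: real
  assumes \<alpha>: "0 < \<alpha>" and r: "1 < r" and \<alpha>r: "\<alpha> * r < 1"
  obtains C :: real where "C > 0"
    "\<And>h B z. h \<in> borel_measurable borel \<Longrightarrow> (\<And>y. 0 \<le> h y) \<Longrightarrow>
       (\<integral>\<^sup>+y. ennreal (h y powr r) \<partial>lborel) \<le> 1 \<Longrightarrow> 0 < B \<Longrightarrow>
       (\<integral>\<^sup>+y. ennreal (if h y \<le> B then h y * \<bar>z - y\<bar> powr (\<alpha> - 1) else 0) \<partial>lborel)
         \<le> ennreal (C * B powr (1 - r * \<alpha>))"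
proof -
  define r' where "r' = r / (r - 1)"
  have r': "r' > 1" "1 / r + 1 / r' = 1" using r by (auto simp: r'_def field_simps)
  have \<alpha>r': "(\<alpha> - 1) * r' < -1"
    using r \<alpha>r by (simp add: r'_def field_simps)
  \<comment> \<open>Near and far radial integrals, each doubled for the two sides of
    \<open>z\<close>; the \<open>1\<close> is the mass of \<open>h powr r\<close> left by Young's
    inequality.\<close>
  define C where "C = 2 / \<alpha> + 2 / (- ((\<alpha> - 1) * r' + 1)) + 1"
  have "C > 0" unfolding C_def using \<alpha> \<alpha>r' by (intro add_pos_pos) (auto intro!: divide_pos_pos)
  moreover have "(\<integral>\<^sup>+y. ennreal (if h y \<le> B then h y * \<bar>z - y\<bar> powr (\<alpha> - 1) else 0) \<partial>lborel)
         \<le> ennreal (C * B powr (1 - r * \<alpha>))"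
    if h[measurable]: "h \<in> borel_measurable borel" and h0: "\<And>y. 0 \<le> h y"
      and hr: "(\<integral>\<^sup>+y. ennreal (h y powr r) \<partial>lborel) \<le> 1" and B: "0 < B" for h B z
  proof -
    \<comment> \<open>\<open>R\<close> makes \<open>B * R powr \<alpha>\<close> equal to
      \<open>E\<close>. In Young's inequality \<open>E\<close> is the weight of
      \<open>h powr r\<close>; this forces \<open>D\<close> to be the reciprocal of
      \<open>E powr (r' / r)\<close>, and then \<open>D * R powr ((\<alpha> - 1) * r' + 1)\<close>
      is \<open>E\<close> again.\<close>
    define R where "R = B powr (- r)"
    define E where "E = B powr (1 - r * \<alpha>)"
    define D where "D = B powr (- ((1 - r * \<alpha>) / (r - 1)))"
    define F where "F t = ennreal (B * t powr (\<alpha> - 1)) * indicator {0..R} t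
        + ennreal (D * t powr ((\<alpha> - 1) * r')) * indicator {R..} t" for t
    have R: "R > 0" and E: "E > 0" and D: "D > 0" using B by (auto simp: R_def E_def D_def)
    have [measurable]: "F \<in> borel_measurable borel" unfolding F_def by measurable
    have young: "h y * \<bar>z - y\<bar> powr (\<alpha> - 1) \<le> E * h y powr r + D * \<bar>z - y\<bar> powr ((\<alpha> - 1) * r')" for y
    proof -
      define c where "c = E powr (1 / r)"
      have c: "c > 0" using E by (simp add: c_def)
      have c1: "(c * h y) powr r = E * h y powr r"
        using r E by (simp add: c_def powr_mult powr_powr h0)
      have "(1 - r * \<alpha>) * (1 / r) * r' = (1 - r * \<alpha>) / (r - 1)"
        using r by (simp add: r'_def field_simps)
      then have "c powr r' = inverse D"
        unfolding c_def E_def D_def powr_powr by (simp flip: powr_minus)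
      then have c2: "(\<bar>z - y\<bar> powr (\<alpha> - 1) / c) powr r' = D * \<bar>z - y\<bar> powr ((\<alpha> - 1) * r')"
        using c D by (simp add: powr_divide powr_powr field_simps)
      have "h y * \<bar>z - y\<bar> powr (\<alpha> - 1) = (c * h y) * (\<bar>z - y\<bar> powr (\<alpha> - 1) / c)"
        using c by simp
      also have "\<dots> \<le> (c * h y) powr r / r + (\<bar>z - y\<bar> powr (\<alpha> - 1) / c) powr r' / r'"
        using r r' c h0 by (intro Youngs_inequality) auto
      also have "\<dots> \<le> (c * h y) powr r + (\<bar>z - y\<bar> powr (\<alpha> - 1) / c) powr r'"
        using r r' by (intro add_mono) (simp_all add: divide_le_eq mult_left_le_one_le mult_le_cancel_left1)
      finally show ?thesis by (simp add: c1 c2)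
    qed
    have "(\<integral>\<^sup>+y. F \<bar>z - y\<bar> \<partial>lborel) = (\<integral>\<^sup>+t. F \<bar>t\<bar> \<partial>lborel)"
      using nn_integral_real_affine[of "\<lambda>t. F \<bar>t\<bar>" "-1" z] by simp
    also have "\<dots> \<le> 2 * (\<integral>\<^sup>+t. F t * indicator {0..} t \<partial>lborel)"
      by (rule nn_integral_even_le) measurable
    finally have F1: "(\<integral>\<^sup>+y. F \<bar>z - y\<bar> \<partial>lborel) \<le> 2 * (\<integral>\<^sup>+t. F t * indicator {0..} t \<partial>lborel)" .
    have "(\<integral>\<^sup>+t. F t * indicator {0..} t \<partial>lborel) =
        (\<integral>\<^sup>+t. ennreal B * (ennreal (t powr (\<alpha> - 1)) * indicator {0..R} t)
             + ennreal D * (ennreal (t powr ((\<alpha> - 1) * r')) * indicator {R..} t) \<partial>lborel)"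
      using R B D by (intro nn_integral_cong) (auto simp: F_def indicator_def ennreal_mult)
    also have "\<dots> = ennreal B * ennreal (R powr \<alpha> / \<alpha>)
        + ennreal D * ennreal (- (R powr ((\<alpha> - 1) * r' + 1)) / ((\<alpha> - 1) * r' + 1))"
      using nn_integral_powr_from_0[of "\<alpha> - 1" R] nn_integral_powr_to_inf[of "(\<alpha> - 1) * r'" R] \<alpha> \<alpha>r' R
      by (subst nn_integral_add) (auto simp: nn_integral_cmult)
    also have "ennreal B * ennreal (R powr \<alpha> / \<alpha>) = ennreal (E / \<alpha>)"
    proof -
      have "B * R powr \<alpha> = E"
        unfolding R_def E_def powr_powr using B by (simp add: powr_mult_base)
      then show ?thesis using B \<alpha> by (simp flip: ennreal_mult')
    qed
    also have "ennreal D * ennreal (- (R powr ((\<alpha> - 1) * r' + 1)) / ((\<alpha> - 1) * r' + 1))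
        = ennreal (E / (- ((\<alpha> - 1) * r' + 1)))"
    proof -
      define q where "q = (r * \<alpha> - 1) / (r - 1)"
      have "(\<alpha> - 1) * r' + 1 = q" "- ((1 - r * \<alpha>) / (r - 1)) = q" "q * (r - 1) = r * \<alpha> - 1"
        using r by (simp_all add: q_def r'_def field_simps)
      then have "- ((1 - r * \<alpha>) / (r - 1)) + - r * ((\<alpha> - 1) * r' + 1) = 1 - r * \<alpha>"
        by (simp add: algebra_simps)
      then have "D * R powr ((\<alpha> - 1) * r' + 1) = E"
        unfolding R_def E_def D_def powr_powr by (simp flip: powr_add)
      then have "D * (- (R powr ((\<alpha> - 1) * r' + 1)) / ((\<alpha> - 1) * r' + 1)) = E / (- ((\<alpha> - 1) * r' + 1))"
        using \<alpha>r' by (simp add: divide_simps) (simp add: algebra_simps)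
      then show ?thesis using D by (simp only: ennreal_mult'[symmetric] less_imp_le)
    qed
    finally have F2: "(\<integral>\<^sup>+t. F t * indicator {0..} t \<partial>lborel)
        = ennreal (E / \<alpha>) + ennreal (E / (- ((\<alpha> - 1) * r' + 1)))" .
    have "(\<integral>\<^sup>+y. ennreal (if h y \<le> B then h y * \<bar>z - y\<bar> powr (\<alpha> - 1) else 0) \<partial>lborel)
        \<le> (\<integral>\<^sup>+y. F \<bar>z - y\<bar> + ennreal E * ennreal (h y powr r) \<partial>lborel)"
    proof (intro nn_integral_mono)
      fix y
      show "ennreal (if h y \<le> B then h y * \<bar>z - y\<bar> powr (\<alpha> - 1) else 0)
          \<le> F \<bar>z - y\<bar> + ennreal E * ennreal (h y powr r)"
      proof (cases "\<bar>z - y\<bar> \<le> R")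
        case True
        have "ennreal (if h y \<le> B then h y * \<bar>z - y\<bar> powr (\<alpha> - 1) else 0) \<le> ennreal (B * \<bar>z - y\<bar> powr (\<alpha> - 1))"
          using B by (intro ennreal_leI) (auto intro: mult_right_mono)
        also have "\<dots> \<le> F \<bar>z - y\<bar>" using True by (simp add: F_def)
        finally show ?thesis by (rule order_trans) simp
      next
        case False
        have "ennreal (if h y \<le> B then h y * \<bar>z - y\<bar> powr (\<alpha> - 1) else 0)
            \<le> ennreal (E * h y powr r + D * \<bar>z - y\<bar> powr ((\<alpha> - 1) * r'))"
          using young[of y] E D by (intro ennreal_leI) (auto intro: add_nonneg_nonneg)
        also have "\<dots> = ennreal E * ennreal (h y powr r) + ennreal (D * \<bar>z - y\<bar> powr ((\<alpha> - 1) * r'))"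
          using E D by (simp add: ennreal_plus ennreal_mult)
        also have "\<dots> \<le> F \<bar>z - y\<bar> + ennreal E * ennreal (h y powr r)"
          using False by (simp add: F_def add.commute)
        finally show ?thesis .
      qed
    qed
    also have "\<dots> = (\<integral>\<^sup>+y. F \<bar>z - y\<bar> \<partial>lborel) + ennreal E * (\<integral>\<^sup>+y. ennreal (h y powr r) \<partial>lborel)"
      by (subst nn_integral_add) (auto simp: nn_integral_cmult)
    also have "\<dots> \<le> 2 * (ennreal (E / \<alpha>) + ennreal (E / (- ((\<alpha> - 1) * r' + 1)))) + ennreal E * 1"
      using hr F1 unfolding F2 by (intro add_mono mult_left_mono) auto
    also have "\<dots> = ennreal (2 * (E / \<alpha> + E / (- ((\<alpha> - 1) * r' + 1))) + E)"
    proof -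
      have two: "2 * (ennreal a + ennreal b) + ennreal c * 1 = ennreal (2 * (a + b) + c)"
        if "a \<ge> 0" "b \<ge> 0" "c \<ge> 0" for a b c
        using that by (simp only: mult_1_right mult_2 ennreal_plus add_nonneg_nonneg)
      show ?thesis by (rule two) (use E \<alpha> \<alpha>r' in auto)
    qed
    also have "2 * (E / \<alpha> + E / (- ((\<alpha> - 1) * r' + 1))) + E = C * E"
      unfolding C_def by (simp add: distrib_right distrib_left)
    finally show ?thesis by (simp only: E_def)
  qed
  ultimately show thesis using that by blast
qed

text \<open>The form over \<open>f x * h y\<close> is cut along \<open>h y powr r = f x powr p\<close>: on either side one of
  the two functions is bounded in terms of the other, which replaces the maximal function.\<close>

lemma riesz_bilinear_half:
  fixes \<alpha> p r :: real
  assumes \<alpha>: "0 < \<alpha>" and p: "1 < p" and r: "1 < r" and pr: "1 / p + 1 / r = 1 + \<alpha>"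
  obtains C :: real where "C > 0"
    "\<And>f h c. f \<in> borel_measurable borel \<Longrightarrow> h \<in> borel_measurable borel \<Longrightarrow>
       (\<And>x. 0 \<le> f x) \<Longrightarrow> (\<And>y. 0 \<le> h y) \<Longrightarrow>
       (\<integral>\<^sup>+x. ennreal (f x powr p) \<partial>lborel) \<le> 1 \<Longrightarrow> (\<integral>\<^sup>+y. ennreal (h y powr r) \<partial>lborel) \<le> 1 \<Longrightarrow>
       (\<integral>\<^sup>+x. \<integral>\<^sup>+y. ennreal (f x) * ennreal (if h y \<le> f x powr (p / r)
            then h y * \<bar>x - c - y\<bar> powr (\<alpha> - 1) else 0) \<partial>lborel \<partial>lborel) \<le> ennreal C"
proof -
  \<comment> \<open>Given the balance \<open>pr\<close>, this is just another form of
    \<open>1 < p\<close>.\<close>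
  have \<alpha>r: "\<alpha> * r < 1"
  proof -
    have "\<alpha> * r = (1 / p - 1) * r + 1" using r pr by (simp add: field_simps)
    moreover have "(1 / p - 1) * r < 0" using p r by (intro mult_neg_pos) auto
    ultimately show ?thesis by simp
  qed
  obtain C where C: "C > 0" and H: "\<And>h B z. h \<in> borel_measurable borel \<Longrightarrow> (\<And>y. 0 \<le> h y) \<Longrightarrow>
       (\<integral>\<^sup>+y. ennreal (h y powr r) \<partial>lborel) \<le> 1 \<Longrightarrow> 0 < B \<Longrightarrow>
       (\<integral>\<^sup>+y. ennreal (if h y \<le> B then h y * \<bar>z - y\<bar> powr (\<alpha> - 1) else 0) \<partial>lborel)
         \<le> ennreal (C * B powr (1 - r * \<alpha>))"
    by (fact riesz_potential_truncated[OF \<alpha> r \<alpha>r])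
  have "(\<integral>\<^sup>+x. \<integral>\<^sup>+y. ennreal (f x) * ennreal (if h y \<le> f x powr (p / r)
            then h y * \<bar>x - c - y\<bar> powr (\<alpha> - 1) else 0) \<partial>lborel \<partial>lborel) \<le> ennreal C"
    if [measurable]: "f \<in> borel_measurable borel" "h \<in> borel_measurable borel"
      and f0: "\<And>x. 0 \<le> f x" and h0: "\<And>y. 0 \<le> h y"
      and fp: "(\<integral>\<^sup>+x. ennreal (f x powr p) \<partial>lborel) \<le> 1"
      and hr: "(\<integral>\<^sup>+y. ennreal (h y powr r) \<partial>lborel) \<le> 1" for f h c
  proof -
    \<comment> \<open>The inner integral over the region cut at height
      \<open>f x powr (p / r)\<close> is bounded by this power of \<open>f x\<close>; the outer
      factor \<open>f x\<close> completes it to \<open>f x powr p\<close>, which is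
      integrable.\<close>
    have exp: "(p / r) * (1 - r * \<alpha>) = p - 1"
    proof -
      have "(p / r) * (1 - r * \<alpha>) = p * (1 / r - \<alpha>)" using r by (simp add: field_simps)
      also have "1 / r - \<alpha> = 1 - 1 / p" using pr by simp
      also have "p * (1 - 1 / p) = p - 1" using p by (simp add: field_simps)
      finally show ?thesis .
    qed
    have "(\<integral>\<^sup>+x. \<integral>\<^sup>+y. ennreal (f x) * ennreal (if h y \<le> f x powr (p / r)
            then h y * \<bar>x - c - y\<bar> powr (\<alpha> - 1) else 0) \<partial>lborel \<partial>lborel)
        \<le> (\<integral>\<^sup>+x. ennreal C * ennreal (f x powr p) \<partial>lborel)"
    proof (intro nn_integral_mono)
      fix x
      have "(\<integral>\<^sup>+y. ennreal (f x) * ennreal (if h y \<le> f x powr (p / r)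
            then h y * \<bar>x - c - y\<bar> powr (\<alpha> - 1) else 0) \<partial>lborel)
          = ennreal (f x) * (\<integral>\<^sup>+y. ennreal (if h y \<le> f x powr (p / r)
            then h y * \<bar>x - c - y\<bar> powr (\<alpha> - 1) else 0) \<partial>lborel)"
        by (rule nn_integral_cmult) measurable
      also have "\<dots> \<le> ennreal C * ennreal (f x powr p)"
      proof (cases "f x = 0")
        case False
        then have fx: "f x > 0" using f0[of x] by simp
        have "ennreal (f x) * (\<integral>\<^sup>+y. ennreal (if h y \<le> f x powr (p / r)
            then h y * \<bar>x - c - y\<bar> powr (\<alpha> - 1) else 0) \<partial>lborel)
            \<le> ennreal (f x) * ennreal (C * (f x powr (p / r)) powr (1 - r * \<alpha>))"
          using fx by (intro mult_left_mono H h0 hr) auto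
        also have "(f x powr (p / r)) powr (1 - r * \<alpha>) = f x powr (p - 1)"
          by (simp only: powr_powr exp)
        also have "ennreal (f x) * ennreal (C * f x powr (p - 1)) = ennreal (C * (f x * f x powr (p - 1)))"
          using C fx by (simp add: mult.left_commute flip: ennreal_mult')
        also have "f x * f x powr (p - 1) = f x powr p"
          using fx by (simp add: powr_mult_base)
        finally show ?thesis using C by (simp add: ennreal_mult)
      qed simp
      finally show "(\<integral>\<^sup>+y. ennreal (f x) * ennreal (if h y \<le> f x powr (p / r)
            then h y * \<bar>x - c - y\<bar> powr (\<alpha> - 1) else 0) \<partial>lborel) \<le> ennreal C * ennreal (f x powr p)" .
    qed
    also have "\<dots> = ennreal C * (\<integral>\<^sup>+x. ennreal (f x powr p) \<partial>lborel)"
      by (rule nn_integral_cmult) measurable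
    also have "\<dots> \<le> ennreal C * 1" using fp by (rule mult_left_mono) simp
    finally show ?thesis by simp
  qed
  with C show thesis using that by blast
qed

text \<open>What the preceding estimate leaves out is contained in its mirror image, with
  \<open>f\<close>, \<open>p\<close> and \<open>h\<close>, \<open>r\<close> exchanged, so two
  applications cover the plane. The shift \<open>c\<close>, on which the constant does not depend,
  serves the singularities that a periodic kernel has at \<open>2 * pi\<close> and
  \<open>- 2 * pi\<close>.\<close>

lemma hardy_littlewood_sobolev_bilinear:
  fixes \<alpha> p r :: real
  assumes \<alpha>: "0 < \<alpha>" and p: "1 < p" and r: "1 < r" and pr: "1 / p + 1 / r = 1 + \<alpha>"
  obtains C :: real where "C > 0"
    "\<And>f h c. f \<in> borel_measurable borel \<Longrightarrow> h \<in> borel_measurable borel \<Longrightarrow>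
       (\<And>x. 0 \<le> f x) \<Longrightarrow> (\<And>y. 0 \<le> h y) \<Longrightarrow>
       (\<integral>\<^sup>+x. ennreal (f x powr p) \<partial>lborel) \<le> 1 \<Longrightarrow> (\<integral>\<^sup>+y. ennreal (h y powr r) \<partial>lborel) \<le> 1 \<Longrightarrow>
       (\<integral>\<^sup>+x. \<integral>\<^sup>+y. ennreal (f x * h y * \<bar>x - c - y\<bar> powr (\<alpha> - 1)) \<partial>lborel \<partial>lborel) \<le> ennreal C"
proof -
  obtain C1 where C1: "C1 > 0" and H1: "\<And>f h c. f \<in> borel_measurable borel \<Longrightarrow> h \<in> borel_measurable borel \<Longrightarrow>
       (\<And>x. 0 \<le> f x) \<Longrightarrow> (\<And>y. 0 \<le> h y) \<Longrightarrow>
       (\<integral>\<^sup>+x. ennreal (f x powr p) \<partial>lborel) \<le> 1 \<Longrightarrow> (\<integral>\<^sup>+y. ennreal (h y powr r) \<partial>lborel) \<le> 1 \<Longrightarrow>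
       (\<integral>\<^sup>+x. \<integral>\<^sup>+y. ennreal (f x) * ennreal (if h y \<le> f x powr (p / r)
            then h y * \<bar>x - c - y\<bar> powr (\<alpha> - 1) else 0) \<partial>lborel \<partial>lborel) \<le> ennreal C1"
    by (fact riesz_bilinear_half[OF assms])
  have rp: "1 / r + 1 / p = 1 + \<alpha>" using pr by simp
  obtain C2 where C2: "C2 > 0" and H2: "\<And>f h c. f \<in> borel_measurable borel \<Longrightarrow> h \<in> borel_measurable borel \<Longrightarrow>
       (\<And>x. 0 \<le> f x) \<Longrightarrow> (\<And>y. 0 \<le> h y) \<Longrightarrow>
       (\<integral>\<^sup>+x. ennreal (f x powr r) \<partial>lborel) \<le> 1 \<Longrightarrow> (\<integral>\<^sup>+y. ennreal (h y powr p) \<partial>lborel) \<le> 1 \<Longrightarrow>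
       (\<integral>\<^sup>+x. \<integral>\<^sup>+y. ennreal (f x) * ennreal (if h y \<le> f x powr (r / p)
            then h y * \<bar>x - c - y\<bar> powr (\<alpha> - 1) else 0) \<partial>lborel \<partial>lborel) \<le> ennreal C2"
    by (fact riesz_bilinear_half[OF \<alpha> r p rp])
  have "(\<integral>\<^sup>+x. \<integral>\<^sup>+y. ennreal (f x * h y * \<bar>x - c - y\<bar> powr (\<alpha> - 1)) \<partial>lborel \<partial>lborel) \<le> ennreal (C1 + C2)"
    if [measurable]: "f \<in> borel_measurable borel" "h \<in> borel_measurable borel"
      and f0: "\<And>x. 0 \<le> f x" and h0: "\<And>y. 0 \<le> h y"
      and fp: "(\<integral>\<^sup>+x. ennreal (f x powr p) \<partial>lborel) \<le> 1"
      and hr: "(\<integral>\<^sup>+y. ennreal (h y powr r) \<partial>lborel) \<le> 1" for f h c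
  proof -
    define U where "U x y = ennreal (f x) * ennreal (if h y \<le> f x powr (p / r)
            then h y * \<bar>x - c - y\<bar> powr (\<alpha> - 1) else 0)" for x y
    \<comment> \<open>Exchanging the variables turns the shift \<open>c\<close> into
      \<open>- c\<close>.\<close>
    define V where "V x y = ennreal (h y) * ennreal (if f x \<le> h y powr (r / p)
            then f x * \<bar>y - (- c) - x\<bar> powr (\<alpha> - 1) else 0)" for x y
    have UV: "ennreal (f x * h y * \<bar>x - c - y\<bar> powr (\<alpha> - 1)) \<le> U x y + V x y" for x y
    proof (cases "h y \<le> f x powr (p / r)")
      case True
      then have "ennreal (f x * h y * \<bar>x - c - y\<bar> powr (\<alpha> - 1)) = U x y"
        using f0 by (simp add: U_def mult.assoc flip: ennreal_mult')
      then show ?thesis by simp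
    next
      case False
      then have "(f x powr (p / r)) powr (r / p) \<le> h y powr (r / p)"
        using p r by (intro powr_mono2) auto
      then have "f x \<le> h y powr (r / p)"
        using p r f0 by (simp add: powr_powr)
      moreover have "\<bar>y - (- c) - x\<bar> = \<bar>x - c - y\<bar>" by simp
      ultimately have "ennreal (f x * h y * \<bar>x - c - y\<bar> powr (\<alpha> - 1)) = V x y"
        using h0 by (simp add: V_def mult.assoc mult.left_commute flip: ennreal_mult')
      then show ?thesis by simp
    qed
    have [measurable]: "case_prod U \<in> borel_measurable (borel \<Otimes>\<^sub>M borel)"
       "case_prod V \<in> borel_measurable (borel \<Otimes>\<^sub>M borel)"
      unfolding U_def V_def by measurable
    have "(\<integral>\<^sup>+x. \<integral>\<^sup>+y. ennreal (f x * h y * \<bar>x - c - y\<bar> powr (\<alpha> - 1)) \<partial>lborel \<partial>lborel)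
        \<le> (\<integral>\<^sup>+x. \<integral>\<^sup>+y. U x y + V x y \<partial>lborel \<partial>lborel)"
      by (intro nn_integral_mono UV)
    also have "\<dots> = (\<integral>\<^sup>+x. (\<integral>\<^sup>+y. U x y \<partial>lborel) + (\<integral>\<^sup>+y. V x y \<partial>lborel) \<partial>lborel)"
      by (intro nn_integral_cong nn_integral_add) auto
    also have "\<dots> = (\<integral>\<^sup>+x. \<integral>\<^sup>+y. U x y \<partial>lborel \<partial>lborel) + (\<integral>\<^sup>+x. \<integral>\<^sup>+y. V x y \<partial>lborel \<partial>lborel)"
      by (intro nn_integral_add) auto
    also have "(\<integral>\<^sup>+x. \<integral>\<^sup>+y. V x y \<partial>lborel \<partial>lborel) = (\<integral>\<^sup>+y. \<integral>\<^sup>+x. V x y \<partial>lborel \<partial>lborel)"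
      by (rule lborel_pair.Fubini') auto
    also have "(\<integral>\<^sup>+x. \<integral>\<^sup>+y. U x y \<partial>lborel \<partial>lborel) + (\<integral>\<^sup>+y. \<integral>\<^sup>+x. V x y \<partial>lborel \<partial>lborel)
        \<le> ennreal C1 + ennreal C2"
      unfolding U_def V_def by (intro add_mono H1 H2 that)
    finally show ?thesis using C1 C2 by simp
  qed
  with C1 C2 show thesis using that[of "C1 + C2"] by simp
qed

section \<open>Kernels of multipliers of bounded dyadic variation\<close>

text \<open>Jordan's inequality: by concavity the sine lies above its chord over
  \<open>{0..pi / 2}\<close>.\<close>

lemma sin_ge_linear:
  assumes "0 \<le> u" "u \<le> pi / 2"
  shows "sin u \<ge> 2 * u / pi"
proof -
  have "convex_on {0..pi/2} (\<lambda>x. - sin x)"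
    by (rule f''_ge0_imp_convex[where f' = "\<lambda>x. - cos x" and f'' = sin])
       (auto intro!: derivative_eq_intros sin_ge_zero)
  from convex_onD[OF this, of "u / (pi / 2)" 0 "pi / 2"] assms
  show ?thesis by (simp add: field_simps)
qed

text \<open>Differences of two points of a period fill \<open>{- 2 * pi..2 * pi}\<close>, where
  \<open>sin (t / 2)\<close> vanishes at the centre and at both ends. Jordan's inequality bounds the
  sine below by the distance to the nearest zero divided by \<open>pi\<close>; the nonpositive power
  reverses this, and adding the terms of all three zeros avoids a case distinction later.\<close>

lemma abs_sin_half_powr_le:
  fixes e t :: real
  assumes "e \<le> 0" "\<bar>t\<bar> \<le> 2 * pi" "sin (t / 2) \<noteq> 0"
  shows "\<bar>sin (t / 2)\<bar> powr e
     \<le> pi powr (- e) * (\<bar>t\<bar> powr e + \<bar>t - 2 * pi\<bar> powr e + \<bar>t + 2 * pi\<bar> powr e)"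
proof -
  have t: "t \<noteq> 0" "t \<noteq> 2 * pi" "t \<noteq> - 2 * pi" using assms(3) by auto
  have key: "\<bar>sin (t / 2)\<bar> powr e \<le> pi powr (- e) * d powr e" if "d > 0" "\<bar>sin (t / 2)\<bar> \<ge> d / pi" for d
  proof -
    have "\<bar>sin (t / 2)\<bar> powr e \<le> (d / pi) powr e"
      using that assms by (intro powr_mono2') auto
    also have "\<dots> = pi powr (- e) * d powr e"
      using that by (simp add: powr_divide powr_minus field_simps)
    finally show ?thesis .
  qed
  define u where "u = \<bar>t\<bar> / 2"
  have su: "\<bar>sin (t / 2)\<bar> = sin u"
    using assms sin_ge_zero[of "\<bar>t\<bar> / 2"] by (auto simp: u_def abs_if)
  consider "u \<le> pi / 2" | "u \<ge> pi / 2" "t > 0" | "u \<ge> pi / 2" "t < 0" using t by linarith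
  then have "\<exists>d\<in>{\<bar>t\<bar>, \<bar>t - 2 * pi\<bar>, \<bar>t + 2 * pi\<bar>}. d > 0 \<and> \<bar>sin (t / 2)\<bar> \<ge> d / pi"
  proof cases
    case 1
    then show ?thesis using sin_ge_linear[of u] t unfolding su by (auto simp: u_def)
  next
    case 2
    then show ?thesis using sin_ge_linear[of "pi - u"] t assms(2) unfolding su
      by (intro bexI[of _ "\<bar>t - 2 * pi\<bar>"]) (auto simp: u_def)
  next
    case 3
    then show ?thesis using sin_ge_linear[of "pi - u"] t assms(2) unfolding su
      by (intro bexI[of _ "\<bar>t + 2 * pi\<bar>"]) (auto simp: u_def add.commute)
  qed
  then obtain d where "d \<in> {\<bar>t\<bar>, \<bar>t - 2 * pi\<bar>, \<bar>t + 2 * pi\<bar>}" "d > 0" "\<bar>sin (t / 2)\<bar> \<ge> d / pi" by blast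
  then have "\<bar>sin (t / 2)\<bar> powr e \<le> pi powr (- e) * d powr e"
    and "d powr e \<le> \<bar>t\<bar> powr e + \<bar>t - 2 * pi\<bar> powr e + \<bar>t + 2 * pi\<bar> powr e"
    using key by auto
  then show ?thesis by (meson mult_left_mono order_trans powr_ge_zero)
qed

text \<open>Multiplication by \<open>2 * sin (t / 2)\<close> makes the sum telescope to a difference
  of two sines. The product form needs no exception at the zeros of the sine.\<close>

lemma abs_cos_sum_le:
  fixes t \<theta> :: real
  shows "\<bar>sin (t / 2)\<bar> * \<bar>\<Sum>k\<in>{a..<b}. cos (real k * t - \<theta>)\<bar> \<le> 1"
proof (cases "a \<le> b")
  case True
  have "2 * sin (t / 2) * (\<Sum>k\<in>{a..<b}. cos (real k * t - \<theta>))
      = sin ((real b - 1 / 2) * t - \<theta>) - sin ((real a - 1 / 2) * t - \<theta>)"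
    using True
  proof (induction b rule: dec_induct)
    case base
    then show ?case by simp
  next
    case (step n)
    have "sin ((real n * t - \<theta>) + t / 2) - sin ((real n * t - \<theta>) - t / 2) = 2 * sin (t / 2) * cos (real n * t - \<theta>)"
      by (simp add: sin_add sin_diff)
    moreover have "(real n * t - \<theta>) + t / 2 = (real (Suc n) - 1 / 2) * t - \<theta>"
      "(real n * t - \<theta>) - t / 2 = (real n - 1 / 2) * t - \<theta>"
      by (simp_all add: algebra_simps)
    ultimately show ?case using step by (simp add: algebra_simps)
  qed
  moreover have "\<bar>sin ((real b - 1 / 2) * t - \<theta>) - sin ((real a - 1 / 2) * t - \<theta>)\<bar> \<le> 2"
    using abs_sin_le_one[of "(real b - 1 / 2) * t - \<theta>"] abs_sin_le_one[of "(real a - 1 / 2) * t - \<theta>"] by linarith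
  ultimately show ?thesis by (simp add: abs_mult[symmetric])
qed simp

text \<open>Summation by parts. Since \<open>S\<close> controls the sums that start at
  \<open>a\<close> itself, the empty sum there is \<open>0\<close> and only the boundary term at
  \<open>b\<close> survives.\<close>

lemma abel_summation_bound:
  fixes m c :: "nat \<Rightarrow> real"
  assumes "a \<le> b" and S: "\<And>k. \<bar>\<Sum>i\<in>{a..<k}. c i\<bar> \<le> S"
  shows "\<bar>\<Sum>k\<in>{a..<b}. m k * c k\<bar> \<le> S * (\<bar>m b\<bar> + (\<Sum>k\<in>{a..<b}. \<bar>m (k + 1) - m k\<bar>))"
proof -
  define T where "T k = (\<Sum>i\<in>{a..<k}. c i)" for k
  have TS: "\<bar>T k\<bar> \<le> S" for k using S by (simp add: T_def)
  have "(\<Sum>k\<in>{a..<b}. m k * c k) = m b * T b - (\<Sum>k\<in>{a..<b}. (m (k + 1) - m k) * T (k + 1))"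
    using assms(1) by (induction b rule: dec_induct) (simp_all add: T_def algebra_simps)
  also have "\<bar>\<dots>\<bar> \<le> \<bar>m b * T b\<bar> + \<bar>\<Sum>k\<in>{a..<b}. (m (k + 1) - m k) * T (k + 1)\<bar>"
    by (rule abs_triangle_ineq4)
  also have "\<dots> \<le> \<bar>m b * T b\<bar> + (\<Sum>k\<in>{a..<b}. \<bar>(m (k + 1) - m k) * T (k + 1)\<bar>)"
    by (intro add_left_mono sum_abs)
  also have "\<dots> \<le> \<bar>m b\<bar> * S + (\<Sum>k\<in>{a..<b}. \<bar>m (k + 1) - m k\<bar> * S)"
    unfolding abs_mult using TS by (intro add_mono sum_mono mult_left_mono) auto
  finally show ?thesis by (simp add: algebra_simps sum_distrib_left)
qed

text \<open>Induction in place of comparison with an integral: the increment of the right-hand side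
  dominates the new term by the weighted inequality of arithmetic and geometric means for
  \<open>n\<close> and \<open>n + 1\<close>.\<close>

lemma sum_powr_neg_le:
  fixes \<alpha> :: real
  assumes "0 < \<alpha>" "\<alpha> < 1"
  shows "(\<Sum>k\<in>{1..n}. real k powr (- \<alpha>)) \<le> real n powr (1 - \<alpha>) / (1 - \<alpha>)"
proof (induction n)
  case (Suc n)
  have "(1 - \<alpha>) * (1 + real n) powr (- \<alpha>) \<le> (1 + real n) powr (1 - \<alpha>) - real n powr (1 - \<alpha>)"
  proof (cases "n = 0")
    case False
    have "real n powr (1 - \<alpha>) * (1 + real n) powr \<alpha> \<le> (1 - \<alpha>) * real n + \<alpha> * (1 + real n)"
      using assms False by (intro Youngs_inequality_0) auto
    also have "\<dots> = (1 + real n) - (1 - \<alpha>)" by (simp add: algebra_simps)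
    finally have "real n powr (1 - \<alpha>) \<le> ((1 + real n) - (1 - \<alpha>)) * (1 + real n) powr (- \<alpha>)"
      by (simp add: powr_minus field_simps)
    also have "\<dots> = (1 + real n) * (1 + real n) powr (- \<alpha>) - (1 - \<alpha>) * (1 + real n) powr (- \<alpha>)"
      by (rule left_diff_distrib)
    also have "(1 + real n) * (1 + real n) powr (- \<alpha>) = (1 + real n) powr (1 - \<alpha>)"
      using powr_mult_base[of "1 + real n" "- \<alpha>"] by simp
    finally show ?thesis by simp
  qed (use assms in auto)
  with Suc assms show ?case by (simp add: field_simps)
qed simp

text \<open>Product rule for differences. On the block the decreasing weight
  \<open>k powr (- \<alpha>)\<close> is at most its first value, and its own variation telescopes to
  at most that value; the variation of \<open>l\<close> and the size of \<open>l\<close> thus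
  contribute \<open>M\<close> times it each, whence the factor \<open>2\<close>.\<close>

lemma weighted_dyadic_variation_le:
  fixes m l :: "nat \<Rightarrow> real"
  assumes \<alpha>: "0 < \<alpha>" and l: "\<And>k. k \<ge> 1 \<Longrightarrow> \<bar>l k\<bar> \<le> M"
    and var: "\<And>j. j \<ge> 1 \<Longrightarrow> (\<Sum>k\<in>{2 ^ j..2 ^ (j + 1)}. \<bar>l (k + 1) - l k\<bar>) \<le> M"
    and m: "\<And>k. k \<ge> 1 \<Longrightarrow> m k = real k powr (- \<alpha>) * l k"
  shows "(\<Sum>k\<in>{2 ^ j..<2 ^ (j + 1)}. \<bar>m (k + 1) - m k\<bar>) \<le> 2 * M * (2 powr (- \<alpha>)) ^ j"
proof (cases "j = 0")
  \<comment> \<open>The variation hypothesis starts with \<open>j = 1\<close>. The block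
    \<open>j = 0\<close> is the single difference of \<open>m 2\<close> and \<open>m 1\<close>, both
    of size at most \<open>M\<close>.\<close>
  case True
  have "2 powr (- \<alpha>) \<le> (1::real)" using powr_mono[of "- \<alpha>" 0 2] \<alpha> by simp
  then have "\<bar>m 1\<bar> \<le> M" "\<bar>m 2\<bar> \<le> M"
    using l[of 1] l[of 2] \<alpha> by (auto simp: m abs_mult intro!: order_trans[OF mult_left_le_one_le])
  then show ?thesis using True by (simp add: numeral_2_eq_2)
next
  case False
  have M: "M \<ge> 0" using l[of 1] by simp
  define w where "w k = real k powr (- \<alpha>)" for k
  have wj: "w (2 ^ j) = (2 powr (- \<alpha>)) ^ j"
    by (simp add: w_def powr_powr powr_realpow[symmetric] mult.commute)
  have wmono: "w i \<le> w k" if "1 \<le> k" "k \<le> i" for i k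
    using that \<alpha> unfolding w_def by (intro powr_mono2') auto
  have "(\<Sum>k\<in>{2 ^ j..<2 ^ (j + 1)}. \<bar>m (k + 1) - m k\<bar>)
      \<le> (\<Sum>k\<in>{2 ^ j..<2 ^ (j + 1)}. w (2 ^ j) * \<bar>l (k + 1) - l k\<bar> + M * (w k - w (k + 1)))"
  proof (intro sum_mono)
    fix k :: nat assume k: "k \<in> {2 ^ j..<2 ^ (j + 1)}"
    have "(1::nat) \<le> 2 ^ j" by simp
    then have k1: "k \<ge> 1" using k by (meson atLeastLessThan_iff order_trans)
    have "m (k + 1) - m k = w (k + 1) * (l (k + 1) - l k) - (w k - w (k + 1)) * l k"
      using k1 by (simp add: m w_def algebra_simps)
    also have "\<bar>\<dots>\<bar> \<le> \<bar>w (k + 1) * (l (k + 1) - l k)\<bar> + \<bar>(w k - w (k + 1)) * l k\<bar>"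
      by (rule abs_triangle_ineq4)
    also have "\<bar>w (k + 1) * (l (k + 1) - l k)\<bar> \<le> w (2 ^ j) * \<bar>l (k + 1) - l k\<bar>"
      using wmono[of "2 ^ j" "k + 1"] k unfolding abs_mult
      by (intro mult_right_mono) (auto simp: w_def)
    also have "\<bar>(w k - w (k + 1)) * l k\<bar> \<le> M * (w k - w (k + 1))"
      using wmono[of k "k + 1"] l[OF k1] k1 unfolding abs_mult
      by (subst mult.commute) (intro mult_mono, auto)
    finally show "\<bar>m (k + 1) - m k\<bar> \<le> w (2 ^ j) * \<bar>l (k + 1) - l k\<bar> + M * (w k - w (k + 1))"
      by simp
  qed
  also have "\<dots> = w (2 ^ j) * (\<Sum>k\<in>{2 ^ j..<2 ^ (j + 1)}. \<bar>l (k + 1) - l k\<bar>)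
      + M * (\<Sum>k\<in>{2 ^ j..<2 ^ (j + 1)}. w k - w (Suc k))"
    by (simp add: sum.distrib sum_distrib_left)
  also have "(\<Sum>k\<in>{2 ^ j..<2 ^ (j + 1)}. w k - w (Suc k)) = w (2 ^ j) - w (2 ^ (j + 1))"
    using sum_Suc_diff'[of "2 ^ j" "2 ^ (j + 1)" "\<lambda>k. - w k"] by simp
  also have "(\<Sum>k\<in>{2 ^ j..<2 ^ (j + 1)}. \<bar>l (k + 1) - l k\<bar>) \<le> (\<Sum>k\<in>{2 ^ j..2 ^ (j + 1)}. \<bar>l (k + 1) - l k\<bar>)"
    by (intro sum_mono2) auto
  also have "\<dots> \<le> M" using var False by simp
  also have "w (2 ^ j) * M + M * (w (2 ^ j) - w (2 ^ (j + 1))) \<le> w (2 ^ j) * M + M * w (2 ^ j)"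
    using M by (intro add_left_mono mult_left_mono) (auto simp: w_def)
  finally show ?thesis by (simp add: wj w_def[of "2 ^ j"] mult_left_mono mult.commute)
qed

text \<open>The dyadic blocks from the one containing \<open>a\<close> onwards form a geometric
  series of ratio \<open>2 powr (- \<alpha>)\<close>, so the tail is comparable to its first
  block.\<close>

lemma tail_variation_le:
  fixes m :: "nat \<Rightarrow> real"
  assumes \<alpha>: "0 < \<alpha>" "\<alpha> < 1" and M: "M \<ge> 0"
    and var: "\<And>j. (\<Sum>k\<in>{2 ^ j..<2 ^ (j + 1)}. \<bar>m (k + 1) - m k\<bar>) \<le> 2 * M * (2 powr (- \<alpha>)) ^ j"
    and "a \<ge> 1"
  shows "(\<Sum>k\<in>{a..<b}. \<bar>m (k + 1) - m k\<bar>) \<le> 4 / (1 - 2 powr (- \<alpha>)) * M * real a powr (- \<alpha>)"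
proof -
  define q where "q = (2::real) powr (- \<alpha>)"
  have "(2::real) powr (- \<alpha>) < 2 powr 0" using \<alpha> by (intro powr_less_mono) auto
  then have q: "0 < q" "q < 1" by (auto simp: q_def)
  obtain i where i: "2 ^ i \<le> a" "a < 2 ^ (i + 1)" using ex_power_ivl1[of 2 a] assms by auto
  have dy: "(\<Sum>k\<in>{2 ^ i..<2 ^ (i + L)}. \<bar>m (k + 1) - m k\<bar>) \<le> 2 * M * q ^ i * (\<Sum>j<L. q ^ j)" for L
  proof (induction L)
    case (Suc L)
    have "(\<Sum>k\<in>{2 ^ i..<2 ^ (i + Suc L)}. \<bar>m (k + 1) - m k\<bar>)
        = (\<Sum>k\<in>{2 ^ i..<2 ^ (i + L)}. \<bar>m (k + 1) - m k\<bar>) + (\<Sum>k\<in>{2 ^ (i + L)..<2 ^ (i + L + 1)}. \<bar>m (k + 1) - m k\<bar>)"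
      by (subst sum.atLeastLessThan_concat) (auto intro: power_increasing)
    also have "\<dots> \<le> 2 * M * q ^ i * (\<Sum>j<L. q ^ j) + 2 * M * q ^ (i + L)"
      using Suc var[of "i + L"] by (intro add_mono) (auto simp: q_def)
    also have "\<dots> = 2 * M * q ^ i * (\<Sum>j<Suc L. q ^ j)"
      by (simp add: algebra_simps power_add)
    finally show ?case .
  qed simp
  have "(\<Sum>k\<in>{a..<b}. \<bar>m (k + 1) - m k\<bar>) \<le> (\<Sum>k\<in>{2 ^ i..<2 ^ (i + b)}. \<bar>m (k + 1) - m k\<bar>)"
  proof (intro sum_mono2)
    \<comment> \<open>The bound does not depend on the number of blocks, so a crude choice of
      \<open>b\<close> blocks, certainly enough to pass \<open>b\<close>, will do.\<close>
    have "b < 2 ^ b" by (rule less_exp)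
    also have "(2::nat) ^ b \<le> 2 ^ (i + b)" by (intro power_increasing) auto
    finally show "{a..<b} \<subseteq> {2 ^ i..<2 ^ (i + b)}" using i by auto
  qed auto
  also have "\<dots> \<le> 2 * M * q ^ i * (\<Sum>j<b. q ^ j)" by (rule dy)
  also have "\<dots> \<le> 2 * M * (2 * real a powr (- \<alpha>)) * (1 / (1 - q))"
  proof (intro mult_mono)
    show "(\<Sum>j<b. q ^ j) \<le> 1 / (1 - q)"
    proof -
      have "(\<Sum>j<b. q ^ j) = (1 - q ^ b) / (1 - q)" using q by (subst sum_gp_strict) auto
      also have "\<dots> \<le> 1 / (1 - q)" using q by (intro divide_right_mono) auto
      finally show ?thesis .
    qed
    \<comment> \<open>As \<open>a < 2 ^ (i + 1)\<close>, the power \<open>q ^ (i + 1)\<close> is at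
      most \<open>a powr (- \<alpha>)\<close>; cancelling one \<open>q\<close> costs
      \<open>2\<close>, because \<open>\<alpha> < 1\<close> gives \<open>q \<ge> 1 / 2\<close>.
      Together with the \<open>2\<close> in \<open>var\<close> this makes the constant
      \<open>4\<close>.\<close>
    show "q ^ i \<le> 2 * real a powr (- \<alpha>)"
    proof -
      have "real a < real (2 ^ (i + 1))" using i(2) by (subst of_nat_less_iff)
      then have "real a \<le> 2 * 2 ^ i" by simp
      then have "(2 * 2 ^ i) powr (- \<alpha>) \<le> real a powr (- \<alpha>)"
        using assms by (intro powr_mono2') auto
      moreover have "(2 * 2 ^ i) powr (- \<alpha>) = q * q ^ i"
        unfolding q_def by (simp add: powr_mult powr_powr powr_realpow[symmetric] mult.commute)
      moreover have "1 / 2 \<le> q"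
        using powr_mono[of "-1" "-\<alpha>" 2] \<alpha> by (simp add: q_def powr_minus)
      moreover from this have "1 / 2 * q ^ i \<le> q * q ^ i"
        using q by (intro mult_right_mono) auto
      ultimately show ?thesis by linarith
    qed
  qed (use M q in \<open>auto intro!: sum_nonneg\<close>)
  also have "\<dots> = 4 / (1 - q) * M * real a powr (- \<alpha>)" by simp
  finally show ?thesis by (simp add: q_def)
qed

text \<open>The sum is split at \<open>k \<approx> 1 / \<bar>sin (t/2)\<bar>\<close>: the head is estimated termwise and the tail by
  Abel summation.\<close>

lemma multiplier_kernel_bound:
  fixes \<alpha> :: real
  assumes \<alpha>: "0 < \<alpha>" "\<alpha> < 1"
  obtains C :: real where "C > 0"
    "\<And>m l M N t \<theta>. (\<And>k. k \<ge> 1 \<Longrightarrow> \<bar>l k\<bar> \<le> M) \<Longrightarrow>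
      (\<And>j. j \<ge> 1 \<Longrightarrow> (\<Sum>k\<in>{2 ^ j..2 ^ (j + 1)}. \<bar>l (k + 1) - l k\<bar>) \<le> M) \<Longrightarrow>
      (\<And>k::nat. k \<ge> 1 \<Longrightarrow> m k = real k powr (- \<alpha>) * l k) \<Longrightarrow> sin (t / 2) \<noteq> 0 \<Longrightarrow>
      \<bar>\<Sum>k\<in>{1..N}. m k * cos (real k * t - \<theta>)\<bar> \<le> C * M * \<bar>sin (t / 2)\<bar> powr (\<alpha> - 1)"
proof -
  define V where "V = 4 / (1 - (2::real) powr (- \<alpha>))"
  have "(2::real) powr (- \<alpha>) < 2 powr 0" using \<alpha> by (intro powr_less_mono) auto
  then have V: "V > 0" by (simp add: V_def)
  \<comment> \<open>The first summand pays for the head; \<open>1 + V\<close> pays for the boundary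
    term and the variation in the tail.\<close>
  define C where "C = 1 / (1 - \<alpha>) + (1 + V)"
  have "C > 0" using \<alpha> V by (auto simp: C_def intro!: add_pos_pos)
  moreover have "\<bar>\<Sum>k\<in>{1..N}. m k * cos (real k * t - \<theta>)\<bar> \<le> C * M * \<bar>sin (t / 2)\<bar> powr (\<alpha> - 1)"
    if l: "\<And>k. k \<ge> 1 \<Longrightarrow> \<bar>l k\<bar> \<le> M"
     and var: "\<And>j. j \<ge> 1 \<Longrightarrow> (\<Sum>k\<in>{2 ^ j..2 ^ (j + 1)}. \<bar>l (k + 1) - l k\<bar>) \<le> M"
     and m: "\<And>k::nat. k \<ge> 1 \<Longrightarrow> m k = real k powr (- \<alpha>) * l k" and t: "sin (t / 2) \<noteq> 0"
   for l m M N t \<theta>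
  proof -
    define c where "c k = cos (real k * t - \<theta>)" for k :: nat
    define y where "y = 1 / \<bar>sin (t / 2)\<bar>"
    have y: "y \<ge> 1" using t by (simp add: y_def)
    have M: "M \<ge> 0" using l[of 1] by simp
    have mle: "\<bar>m k\<bar> \<le> M * real k powr (- \<alpha>)" if "k \<ge> 1" for k
      using l[OF that] m[OF that] by (simp add: abs_mult mult.commute mult_right_mono)
    have cle: "\<bar>c k\<bar> \<le> 1" for k by (simp add: c_def)
    \<comment> \<open>First index beyond \<open>y\<close>. Hence
      \<open>a powr (- \<alpha>) \<le> y powr (- \<alpha>)\<close>, and the factor \<open>y\<close>
      that bounds the cosine sums brings the tail to \<open>y powr (1 - \<alpha>)\<close>, the size
      of the head.\<close>
    define a where "a = nat \<lfloor>y\<rfloor> + 1"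
    have a1: "a \<ge> 1" by (simp add: a_def)
    have ay: "real (nat \<lfloor>y\<rfloor>) \<le> y" "y < real a" using y by (auto simp: a_def) linarith+
    have head: "\<bar>\<Sum>k\<in>{1..L}. m k * c k\<bar> \<le> 1 / (1 - \<alpha>) * M * y powr (1 - \<alpha>)" if "L \<le> nat \<lfloor>y\<rfloor>" for L
    proof -
      have "real L \<le> y" using that ay by linarith
      have "\<bar>\<Sum>k\<in>{1..L}. m k * c k\<bar> \<le> (\<Sum>k\<in>{1..L}. \<bar>m k * c k\<bar>)" by (rule sum_abs)
      also have "\<dots> \<le> (\<Sum>k\<in>{1..L}. M * real k powr (- \<alpha>))"
      proof (intro sum_mono)
        fix k assume "k \<in> {1..L}"
        then show "\<bar>m k * c k\<bar> \<le> M * real k powr (- \<alpha>)"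
          using mult_mono[OF mle[of k] cle[of k]] M by (simp add: abs_mult)
      qed
      also have "\<dots> = M * (\<Sum>k\<in>{1..L}. real k powr (- \<alpha>))" by (simp add: sum_distrib_left)
      also have "\<dots> \<le> M * (real L powr (1 - \<alpha>) / (1 - \<alpha>))"
        using sum_powr_neg_le[OF \<alpha>] M by (intro mult_left_mono)
      also have "\<dots> \<le> M * (y powr (1 - \<alpha>) / (1 - \<alpha>))"
        using \<open>real L \<le> y\<close> \<alpha> M by (intro mult_left_mono divide_right_mono powr_mono2) auto
      finally show ?thesis by simp
    qed
    have tail: "\<bar>\<Sum>k\<in>{a..<b}. m k * c k\<bar> \<le> (1 + V) * M * y powr (1 - \<alpha>)" if "a \<le> b" for b
    proof -
      have S: "\<bar>\<Sum>i\<in>{a..<k}. c i\<bar> \<le> y" for k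
        using abs_cos_sum_le[of t \<theta> a k] t by (simp add: y_def c_def field_simps)
      have "\<bar>\<Sum>k\<in>{a..<b}. m k * c k\<bar> \<le> y * (\<bar>m b\<bar> + (\<Sum>k\<in>{a..<b}. \<bar>m (k + 1) - m k\<bar>))"
        by (rule abel_summation_bound[OF that S])
      also have "\<dots> \<le> y * (M * real a powr (- \<alpha>) + V * M * real a powr (- \<alpha>))"
      proof (intro mult_left_mono add_mono)
        have "\<bar>m b\<bar> \<le> M * real b powr (- \<alpha>)" using mle that a1 by simp
        also have "\<dots> \<le> M * real a powr (- \<alpha>)"
          using M \<alpha> that a1 by (intro mult_left_mono powr_mono2') auto
        finally show "\<bar>m b\<bar> \<le> M * real a powr (- \<alpha>)" .
        show "(\<Sum>k\<in>{a..<b}. \<bar>m (k + 1) - m k\<bar>) \<le> V * M * real a powr (- \<alpha>)"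
          unfolding V_def
          by (rule tail_variation_le[OF \<alpha> M weighted_dyadic_variation_le[OF \<alpha>(1) l var m] a1])
      qed (use y in auto)
      also have "\<dots> = (1 + V) * M * (y * real a powr (- \<alpha>))" by (simp add: algebra_simps)
      also have "\<dots> \<le> (1 + V) * M * (y * y powr (- \<alpha>))"
        using ay y \<alpha> V M by (intro mult_left_mono powr_mono2') auto
      also have "y * y powr (- \<alpha>) = y powr (1 - \<alpha>)" using y by (simp add: powr_mult_base)
      finally show ?thesis .
    qed
    have "\<bar>\<Sum>k\<in>{1..N}. m k * c k\<bar> \<le> C * M * y powr (1 - \<alpha>)"
    proof (cases "N \<le> nat \<lfloor>y\<rfloor>")
      case True
      have "1 / (1 - \<alpha>) * M * y powr (1 - \<alpha>) \<le> C * M * y powr (1 - \<alpha>)"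
        using M V by (intro mult_right_mono) (auto simp: C_def)
      then show ?thesis using head[OF True] by linarith
    next
      case False
      then have "a \<le> Suc N" by (simp add: a_def)
      have "(\<Sum>k\<in>{1..N}. m k * c k) = (\<Sum>k\<in>{1..<a}. m k * c k) + (\<Sum>k\<in>{a..<Suc N}. m k * c k)"
        using \<open>a \<le> Suc N\<close> a1 by (subst sum.atLeastLessThan_concat) (auto simp: atLeastLessThanSuc_atLeastAtMost)
      also have "{1..<a} = {1..nat \<lfloor>y\<rfloor>}" by (auto simp: a_def)
      finally have "\<bar>\<Sum>k\<in>{1..N}. m k * c k\<bar> \<le> 1 / (1 - \<alpha>) * M * y powr (1 - \<alpha>) + (1 + V) * M * y powr (1 - \<alpha>)"
        using head[of "nat \<lfloor>y\<rfloor>"] tail[OF \<open>a \<le> Suc N\<close>] by linarith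
      then show ?thesis by (simp add: C_def algebra_simps)
    qed
    also have "y powr (1 - \<alpha>) = \<bar>sin (t / 2)\<bar> powr (\<alpha> - 1)"
      using t by (simp add: y_def powr_divide powr_diff)
    finally show ?thesis by (simp add: c_def)
  qed
  ultimately show thesis using that by blast
qed

section \<open>Trigonometric polynomials and duality\<close>

text \<open>One family of generators with free phase contains the constants (\<open>n = 0\<close>)
  and the sines (\<open>b = - (pi / 2)\<close>), so a claim stable under addition is checked on a
  single kind of function.\<close>

inductive trig_poly :: "(real \<Rightarrow> real) \<Rightarrow> bool" where
  cos: "trig_poly (\<lambda>x. c * cos (real n * x + b))"
| add: "trig_poly f \<Longrightarrow> trig_poly g \<Longrightarrow> trig_poly (\<lambda>x. f x + g x)"

lemma trig_poly_const: "trig_poly (\<lambda>x. c)"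
  using trig_poly.cos[of c 0 0] by simp

lemma trig_poly_cmult: "trig_poly f \<Longrightarrow> trig_poly (\<lambda>x. c * f x)"
proof (induction rule: trig_poly.induct)
  case (cos d n b)
  then show ?case using trig_poly.cos[of "c * d" n b] by (simp add: mult.assoc)
qed (simp add: distrib_left trig_poly.add)

lemma trig_poly_mult:
  assumes "trig_poly f" "trig_poly g"
  shows "trig_poly (\<lambda>x. f x * g x)"
  using assms(1)
proof (induction rule: trig_poly.induct)
  case (cos c n b)
  show ?case using assms(2)
  proof (induction rule: trig_poly.induct)
    case (cos d m a)
    \<comment> \<open>The difference of the frequencies has to be a natural number, so the larger
      frequency comes first; the other order follows by commutativity.\<close>
    have *: "trig_poly (\<lambda>x. c * cos (real n * x + b) * (d * cos (real m * x + a)))" if "m \<le> n" for c d b a m n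
    proof -
      have "(\<lambda>x. c * cos (real n * x + b) * (d * cos (real m * x + a)))
          = (\<lambda>x. (c * d / 2) * cos (real (n - m) * x + (b - a)) + (c * d / 2) * cos (real (n + m) * x + (b + a)))"
      proof
        fix x
        have "c * cos (real n * x + b) * (d * cos (real m * x + a))
            = c * d * (cos (real n * x + b) * cos (real m * x + a))" by simp
        also have "\<dots> = c * d / 2 * (cos (real n * x + b - (real m * x + a)) + cos (real n * x + b + (real m * x + a)))"
          by (simp add: cos_times_cos)
        also have "real n * x + b - (real m * x + a) = real (n - m) * x + (b - a)"
          using that by (simp add: of_nat_diff algebra_simps)
        also have "real n * x + b + (real m * x + a) = real (n + m) * x + (b + a)"
          by (simp add: algebra_simps)
        finally show "c * cos (real n * x + b) * (d * cos (real m * x + a)) = (c * d / 2) * cos (real (n - m) * x + (b - a))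
            + (c * d / 2) * cos (real (n + m) * x + (b + a))" by (simp add: distrib_left)
      qed
      then show ?thesis by (simp only: trig_poly.intros)
    qed
    show ?case
    proof (cases "m \<le> n")
      case False
      then show ?thesis using *[of n m d a c b] by (simp add: mult_ac)
    qed (rule *)
  qed (simp add: distrib_left trig_poly.add)
qed (simp add: distrib_right trig_poly.add)

lemma trig_poly_continuous: "trig_poly f \<Longrightarrow> continuous_on S f"
  by (induction rule: trig_poly.induct) (auto intro!: continuous_intros)

lemma trig_poly_cos_sin: "trig_poly (\<lambda>x. cos x)" "trig_poly (\<lambda>x. sin x)"
  using trig_poly.cos[of 1 1 0] trig_poly.cos[of 1 1 "- (pi / 2)"] by (auto simp: cos_diff)

text \<open>Brings polynomial approximation on the unit circle back to the line: a real linear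
  functional of \<open>cis x\<close> combines \<open>cos x\<close> and \<open>sin x\<close>, and the
  class is closed under sums and products.\<close>

lemma trig_poly_real_polynomial_cis:
  "real_polynomial_function g \<Longrightarrow> trig_poly (\<lambda>x. g (cis x))"
proof (induction rule: real_polynomial_function.induct)
  case (linear f)
  have "f (cis x) = f 1 * cos x + f \<i> * sin x" for x
  proof -
    have "cis x = cos x *\<^sub>R 1 + sin x *\<^sub>R \<i>" by (simp add: complex_eq_iff)
    then show ?thesis
      using linear by (simp add: linear_add linear_scale bounded_linear.linear)
  qed
  then show ?case
    by (simp add: trig_poly.add trig_poly_cmult trig_poly_cos_sin)
qed (auto intro: trig_poly_const trig_poly_mult trig_poly.add)

text \<open>The function is transplanted to the unit circle, where Stone-Weierstrass applies;
  equality of the end values makes the transplant single-valued at \<open>-1\<close>.\<close>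

lemma trig_poly_approx_continuous:
  fixes \<phi> :: "real \<Rightarrow> real"
  assumes cont: "continuous_on {-pi..pi} \<phi>" and ends: "\<phi> (- pi) = \<phi> pi" and "e > 0"
  obtains \<tau> where "trig_poly \<tau>" "\<And>x. x \<in> {-pi..pi} \<Longrightarrow> \<bar>\<phi> x - \<tau> x\<bar> < e"
proof -
  define F where "F z = \<phi> (Arg z)" for z
  have Fcis: "F (cis x) = \<phi> x" if "x \<in> {-pi..pi}" for x
  proof (cases "x = - pi")
    case True
    then have "cis x = -1" by (simp add: complex_eq_iff)
    moreover have "Arg (-1) = pi" using Arg_of_real[of "-1"] by simp
    ultimately show ?thesis using True ends by (simp add: F_def)
  next
    case False
    then have "Arg (cis x) = x" using that by (intro Arg_unique'[of 1]) (auto simp: rcis_def)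
    then show ?thesis by (simp add: F_def)
  qed
  \<comment> \<open>\<open>Arg\<close> jumps at \<open>-1\<close>, so continuity is not obtained by
    composition. Instead, the preimage of a closed set is the image under \<open>cis\<close> of a
    compact subset of the period.\<close>
  have contF: "continuous_on (sphere 0 1) F"
  proof (subst continuous_on_closed_vimage)
    show "\<forall>B. closed B \<longrightarrow> closed (F -` B \<inter> sphere 0 1)"
    proof (intro allI impI)
      fix B :: "real set" assume B: "closed B"
      have "F -` B \<inter> sphere 0 1 = cis ` (\<phi> -` B \<inter> {-pi..pi})"
      proof (intro equalityI subsetI)
        fix z assume z: "z \<in> F -` B \<inter> sphere 0 1"
        then have "z = cis (Arg z)" using Arg_eq[of z] by (cases "z = 0") (auto simp: cis_conv_exp)
        moreover have "Arg z \<in> \<phi> -` B \<inter> {-pi..pi}"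
          using z Arg_bounded[of z] by (auto simp: F_def)
        ultimately show "z \<in> cis ` (\<phi> -` B \<inter> {-pi..pi})" by blast
      qed (auto simp: Fcis)
      moreover have "closed (\<phi> -` B \<inter> {-pi..pi})"
        using cont B by (subst (asm) continuous_on_closed_vimage) auto
      then have "compact (\<phi> -` B \<inter> {-pi..pi})"
        using compact_Int_closed[OF compact_Icc[of "-pi" pi]] by (simp add: inf.absorb_iff2 Int_ac compact_eq_bounded_closed bounded_Int)
      then have "compact (cis ` (\<phi> -` B \<inter> {-pi..pi}))"
        by (intro compact_continuous_image continuous_intros)
      ultimately show "closed (F -` B \<inter> sphere 0 1)" by (simp add: compact_imp_closed)
    qed
  qed auto
  obtain g where g: "real_polynomial_function g" "\<And>z. z \<in> sphere 0 1 \<Longrightarrow> \<bar>F z - g z\<bar> < e"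
    by (fact Stone_Weierstrass_real_polynomial_function[OF compact_sphere contF \<open>e > 0\<close>])
  show thesis
  proof (rule that[OF trig_poly_real_polynomial_cis[OF g(1)]])
    fix x assume "x \<in> {-pi..pi}"
    then show "\<bar>\<phi> x - g (cis x)\<bar> < e" using g(2)[of "cis x"] Fcis by simp
  qed
qed

text \<open>A measurable function is almost everywhere a limit of continuous ones. Clipping these at
  \<open>B\<close> keeps them bounded, and uniform approximation within \<open>1 / (n + 1)\<close>
  adds at most \<open>1\<close>, whence \<open>B + 1\<close>.\<close>

lemma trig_poly_approx_bounded:
  fixes \<phi> :: "real \<Rightarrow> real"
  assumes meas: "\<phi> \<in> borel_measurable lebesgue" and B: "\<And>x. \<bar>\<phi> x\<bar> \<le> B"
  obtains \<tau> :: "nat \<Rightarrow> real \<Rightarrow> real" where "\<And>k. trig_poly (\<tau> k)"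
    "\<And>k x. x \<in> {-pi..pi} \<Longrightarrow> \<bar>\<tau> k x\<bar> \<le> B + 1"
    "AE x in lebesgue. x \<in> {-pi..pi} \<longrightarrow> (\<lambda>k. \<tau> k x) \<longlonglongrightarrow> \<phi> x"
proof -
  have "B \<ge> 0" using B[of 0] by simp
  have "\<phi> measurable_on UNIV"
    using meas by (intro lebesgue_measurable_imp_measurable_on) auto
  then obtain N g where N: "negligible N" and g: "\<And>n. continuous_on UNIV (g n)"
    and lim: "\<And>x. x \<notin> N \<Longrightarrow> (\<lambda>n. g n x) \<longlonglongrightarrow> \<phi> x"
    unfolding measurable_on_def by auto
  \<comment> \<open>A trapezoid that vanishes at both ends of the period, so that the end values
    agree, and that is eventually \<open>1\<close> at each interior point.\<close>
  define cut where "cut n x = max 0 (min 1 (real n * (pi - \<bar>x\<bar>)))" for n x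
  define h where "h n x = cut n x * max (- B) (min B (g n x))" for n x
  have h: "continuous_on {-pi..pi} (h n)" "h n (- pi) = h n pi" for n
  proof -
    show "continuous_on {-pi..pi} (h n)"
      unfolding h_def cut_def by (intro continuous_intros continuous_on_subset[OF g]) auto
  qed (simp add: h_def cut_def)
  have "\<exists>\<tau>. trig_poly \<tau> \<and> (\<forall>x\<in>{-pi..pi}. \<bar>h n x - \<tau> x\<bar> < 1 / (real n + 1))" for n
    using trig_poly_approx_continuous[OF h, of "1 / (real n + 1)" n] by (metis divide_pos_pos of_nat_0_le_iff zero_less_one add_nonneg_pos)
  then obtain \<tau> where \<tau>: "\<And>n. trig_poly (\<tau> n)"
    "\<And>n x. x \<in> {-pi..pi} \<Longrightarrow> \<bar>h n x - \<tau> n x\<bar> < 1 / (real n + 1)"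
    by metis
  show thesis
  proof (rule that[of \<tau>])
    show "\<bar>\<tau> k x\<bar> \<le> B + 1" if "x \<in> {-pi..pi}" for k x
    proof -
      have "\<bar>h k x\<bar> \<le> 1 * B"
        unfolding h_def abs_mult using \<open>B \<ge> 0\<close> by (intro mult_mono) (auto simp: cut_def)
      moreover have "1 / (real k + 1) \<le> 1" by simp
      ultimately show ?thesis using \<tau>(2)[OF that, of k] by linarith
    qed
    have "AE x in lebesgue. x \<notin> N \<union> {-pi, pi}"
    proof (rule AE_not_in)
      have "negligible (N \<union> {-pi, pi})" using N by (intro negligible_Un) auto
      then show "N \<union> {-pi, pi} \<in> null_sets lebesgue" by (simp only: negligible_iff_null_sets)
    qed
    then show "AE x in lebesgue. x \<in> {-pi..pi} \<longrightarrow> (\<lambda>k. \<tau> k x) \<longlonglongrightarrow> \<phi> x"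
    proof eventually_elim
      case (elim x)
      show ?case
      proof
        assume x: "x \<in> {-pi..pi}"
        then have "pi - \<bar>x\<bar> > 0" using elim by (auto simp: abs_if)
        then have "\<forall>\<^sub>F n in sequentially. real n * (pi - \<bar>x\<bar>) \<ge> 1"
          by real_asymp
        then have "\<forall>\<^sub>F n in sequentially. cut n x = 1"
          by eventually_elim (simp add: cut_def)
        then have "(\<lambda>n. cut n x) \<longlonglongrightarrow> 1" by (rule tendsto_eventually)
        moreover have "(\<lambda>n. max (- B) (min B (g n x))) \<longlonglongrightarrow> max (- B) (min B (\<phi> x))"
          using elim by (intro tendsto_intros lim) auto
        moreover have "max (- B) (min B (\<phi> x)) = \<phi> x" using B[of x] by (auto simp: abs_le_iff)
        ultimately have "(\<lambda>n. h n x) \<longlonglongrightarrow> \<phi> x"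
          unfolding h_def using tendsto_mult[of "\<lambda>n. cut n x" 1 sequentially] by fastforce
        moreover have "(\<lambda>n. h n x - \<tau> n x) \<longlonglongrightarrow> 0"
        proof (rule Lim_null_comparison)
          show "\<forall>\<^sub>F n in sequentially. norm (h n x - \<tau> n x) \<le> 1 / (real n + 1)"
            using \<tau>(2)[OF x] by (auto simp: less_imp_le)
          show "(\<lambda>n. 1 / (real n + 1)) \<longlonglongrightarrow> 0" by real_asymp
        qed
        ultimately have "(\<lambda>n. h n x - (h n x - \<tau> n x)) \<longlonglongrightarrow> \<phi> x - 0"
          by (rule tendsto_diff)
        then show "(\<lambda>k. \<tau> k x) \<longlonglongrightarrow> \<phi> x" by simp
      qed
    qed
  qed (rule \<tau>)
qed

text \<open>Extends the test inequality to bounded measurable \<open>\<phi>\<close> by dominated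
  convergence. The strict bound in the hypothesis on \<open>\<phi>\<close> is essential to the
  argument: the integrals of the approximants merely converge, and strictness makes them admissible
  tests eventually.\<close>

lemma duality_bounded:
  fixes u :: "real \<Rightarrow> real"
  assumes u: "set_integrable lebesgue {-pi..pi} u"
    and dual: "\<And>\<tau>. trig_poly \<tau> \<Longrightarrow>
       (\<integral>\<^sup>+x. ennreal (\<bar>\<tau> x\<bar> powr r) * indicator {-pi..pi} x \<partial>lebesgue) \<le> 1 \<Longrightarrow>
       (LINT x:{-pi..pi}|lebesgue. u x * \<tau> x) \<le> D"
    and r: "r > 0"
    and meas: "\<phi> \<in> borel_measurable lebesgue" and B: "\<And>x. \<bar>\<phi> x\<bar> \<le> B"
    and \<phi>: "(\<integral>\<^sup>+x. ennreal (\<bar>\<phi> x\<bar> powr r) * indicator {-pi..pi} x \<partial>lebesgue) < 1"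
  shows "(LINT x:{-pi..pi}|lebesgue. u x * \<phi> x) \<le> D"
proof -
  obtain \<tau> where \<tau>: "\<And>k. trig_poly (\<tau> k)" and bd: "\<And>k x. x \<in> {-pi..pi} \<Longrightarrow> \<bar>\<tau> k x\<bar> \<le> B + 1"
    and lim: "AE x in lebesgue. x \<in> {-pi..pi} \<longrightarrow> (\<lambda>k. \<tau> k x) \<longlonglongrightarrow> \<phi> x"
    by (fact trig_poly_approx_bounded[OF meas B])
  have "\<tau> k \<in> borel_measurable borel" for k
    by (intro borel_measurable_continuous_onI trig_poly_continuous \<tau>)
  then have [measurable]: "\<tau> k \<in> borel_measurable lebesgue" for k
    by (intro measurable_completion) simp
  note meas[measurable]
  have [measurable]: "{-pi..pi} \<in> sets lebesgue" by simp
  have I: "(\<lambda>x. indicator {-pi..pi} x * u x) \<in> borel_measurable lebesgue"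
    using borel_measurable_integrable[OF u[unfolded set_integrable_def]] by simp
  have B0: "B \<ge> 0" using B[of 0] by simp
  have "(\<lambda>k. \<integral>\<^sup>+x. ennreal (\<bar>\<tau> k x\<bar> powr r) * indicator {-pi..pi} x \<partial>lebesgue)
      \<longlonglongrightarrow> (\<integral>\<^sup>+x. ennreal (\<bar>\<phi> x\<bar> powr r) * indicator {-pi..pi} x \<partial>lebesgue)"
  proof (rule nn_integral_dominated_convergence[where w = "\<lambda>x. ennreal ((B + 1) powr r) * indicator {-pi..pi} x"])
    show "AE x in lebesgue. ennreal (\<bar>\<tau> k x\<bar> powr r) * indicator {-pi..pi} x \<le> ennreal ((B + 1) powr r) * indicator {-pi..pi} x" for k
      using bd r by (intro AE_I2) (auto simp: indicator_def intro!: ennreal_leI powr_mono2)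
    show "(\<integral>\<^sup>+x. ennreal ((B + 1) powr r) * indicator {-pi..pi} x \<partial>lebesgue) < \<infinity>"
      by (subst nn_integral_cmult_indicator) (auto simp: ennreal_mult_less_top)
    show "AE x in lebesgue. (\<lambda>k. ennreal (\<bar>\<tau> k x\<bar> powr r) * indicator {-pi..pi} x)
        \<longlonglongrightarrow> ennreal (\<bar>\<phi> x\<bar> powr r) * indicator {-pi..pi} x"
      using lim
    proof eventually_elim
      case (elim x)
      show ?case
      proof (cases "x \<in> {-pi..pi}")
        case True
        then have "(\<lambda>k. \<bar>\<tau> k x\<bar> powr r) \<longlonglongrightarrow> \<bar>\<phi> x\<bar> powr r"
          using elim r by (intro tendsto_powr2 tendsto_intros) auto
        then show ?thesis using True by (simp add: tendsto_ennrealI)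
      qed simp
    qed
  qed measurable
  then have "\<forall>\<^sub>F k in sequentially. (\<integral>\<^sup>+x. ennreal (\<bar>\<tau> k x\<bar> powr r) * indicator {-pi..pi} x \<partial>lebesgue) < 1"
    using \<phi> by (rule order_tendstoD)
  then have "\<forall>\<^sub>F k in sequentially. (LINT x:{-pi..pi}|lebesgue. u x * \<tau> k x) \<le> D"
    by eventually_elim (intro dual \<tau> less_imp_le)
  moreover have "(\<lambda>k. LINT x:{-pi..pi}|lebesgue. u x * \<tau> k x) \<longlonglongrightarrow> (LINT x:{-pi..pi}|lebesgue. u x * \<phi> x)"
    unfolding set_lebesgue_integral_def
  proof (rule integral_dominated_convergence[where w = "\<lambda>x. (B + 1) * \<bar>indicator {-pi..pi} x * u x\<bar>"])
    show "integrable lebesgue (\<lambda>x. (B + 1) * \<bar>indicator {-pi..pi} x * u x\<bar>)"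
      using u by (intro integrable_mult_right integrable_abs) (simp add: set_integrable_def)
    show "AE x in lebesgue. (\<lambda>k. indicator {-pi..pi} x *\<^sub>R (u x * \<tau> k x)) \<longlonglongrightarrow> indicator {-pi..pi} x *\<^sub>R (u x * \<phi> x)"
      using lim by eventually_elim (auto simp: indicator_def intro!: tendsto_intros)
    show "AE x in lebesgue. norm (indicator {-pi..pi} x *\<^sub>R (u x * \<tau> k x)) \<le> (B + 1) * \<bar>indicator {-pi..pi} x * u x\<bar>" for k
      using bd by (intro AE_I2) (auto simp: indicator_def abs_mult mult.commute[of "B + 1"] intro!: mult_left_mono)
  qed (use I in \<open>auto simp flip: mult.assoc\<close>)
  ultimately show ?thesis by (intro tendsto_upperbound) auto
qed

text \<open>Converse of Hoelder's inequality. Finiteness of the left side is not known beforehand,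
  so the extremal test function is built from the truncation of \<open>\<bar>u\<bar>\<close> at
  height \<open>N\<close>, which makes it bounded and \<open>J\<close> finite. The bound is uniform
  in \<open>N\<close>, and Fatou's lemma removes the truncation.\<close>

lemma trig_poly_dual_bound:
  fixes u :: "real \<Rightarrow> real"
  assumes u: "set_integrable lebesgue {-pi..pi} u" and "D > 0" and r: "r > 1" and rs: "1 / r + 1 / s = 1"
    and dual: "\<And>\<tau>. trig_poly \<tau> \<Longrightarrow>
       (\<integral>\<^sup>+x. ennreal (\<bar>\<tau> x\<bar> powr r) * indicator {-pi..pi} x \<partial>lebesgue) \<le> 1 \<Longrightarrow>
       (LINT x:{-pi..pi}|lebesgue. u x * \<tau> x) \<le> D"
  shows "(\<integral>\<^sup>+x. ennreal (\<bar>u x\<bar> powr s) * indicator {-pi..pi} x \<partial>lebesgue) \<le> ennreal ((2 * D) powr s)"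
proof -
  have s: "s > 1" "(s - 1) * r = s" "1 - 1 / r = 1 / s"
  proof -
    have "1 / r < 1" "1 / r > 0" using r by auto
    then have "1 / s > 0" "1 / s < 1" using rs by linarith+
    then have "s > 0" "1 / s < 1" by simp_all
    then show "s > 1" by simp
    then show "(s - 1) * r = s" "1 - 1 / r = 1 / s" using r rs by (auto simp: field_simps)
  qed
  define v where "v x = indicator {-pi..pi} x * u x" for x
  have v: "integrable lebesgue v" using u by (simp add: v_def[abs_def] set_integrable_def)
  have [measurable]: "v \<in> borel_measurable lebesgue" using v by (rule borel_measurable_integrable)
  have [measurable]: "{-pi..pi} \<in> sets lebesgue" by simp
  have trunc: "(\<integral>\<^sup>+x. ennreal (min \<bar>v x\<bar> (real N) powr s) \<partial>lebesgue) \<le> ennreal ((2 * D) powr s)" for N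
  proof -
    define G where "G x = min \<bar>v x\<bar> (real N)" for x
    have G0: "G x \<ge> 0" "G x \<le> real N" "G x \<le> \<bar>v x\<bar>" for x by (auto simp: G_def)
    have Gout: "G x = 0" if "x \<notin> {-pi..pi}" for x using that by (simp add: G_def v_def)
    have [measurable]: "G \<in> borel_measurable lebesgue" unfolding G_def by measurable
    have intG: "integrable lebesgue (\<lambda>x. G x powr s)"
    proof (rule Bochner_Integration.integrable_bound)
      show "integrable lebesgue (\<lambda>x. real N powr s * indicator {-pi..pi} x)"
        by (intro integrable_mult_right) (simp add: integrable_indicator_iff)
      show "AE x in lebesgue. norm (G x powr s) \<le> norm (real N powr s * indicator {-pi..pi} x)"
        using G0 s Gout by (intro AE_I2) (auto simp: indicator_def intro!: powr_mono2)
    qed measurable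
    define J where "J = (LINT x|lebesgue. G x powr s)"
    have nnJ: "(\<integral>\<^sup>+x. ennreal (G x powr s) \<partial>lebesgue) = ennreal J"
      unfolding J_def by (intro nn_integral_eq_integral intG) auto
    have "J \<ge> 0" unfolding J_def by (intro Bochner_Integration.integral_nonneg) auto
    have "J \<le> (2 * D) powr s"
    proof (cases "J = 0")
      case False
      then have J: "J > 0" using \<open>J \<ge> 0\<close> by simp
      \<comment> \<open>The extremal function for \<open>G\<close>, normalised by
        \<open>J powr (1 / r)\<close> and then halved: the \<open>1 / 2\<close> brings its norm
        strictly below \<open>1\<close>, as \<open>duality_bounded\<close> requires, and reappears
        as the factor \<open>2\<close> in \<open>2 * D\<close>.\<close>
      define \<phi> where "\<phi> x = 1 / 2 * sgn (v x) * (G x powr (s - 1) / J powr (1 / r))" for x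
      have [measurable]: "\<phi> \<in> borel_measurable lebesgue" unfolding \<phi>_def by measurable
      have \<phi>B: "\<bar>\<phi> x\<bar> \<le> real N powr (s - 1) / J powr (1 / r)" for x
      proof -
        have "\<bar>\<phi> x\<bar> = (1 / 2 * \<bar>sgn (v x)\<bar>) * (G x powr (s - 1) / J powr (1 / r))"
          by (simp add: \<phi>_def abs_mult)
        also have "\<dots> \<le> 1 * (real N powr (s - 1) / J powr (1 / r))"
          using G0 s by (intro mult_mono divide_right_mono powr_mono2) (auto simp: abs_sgn_eq)
        finally show ?thesis by simp
      qed
      have \<phi>r: "\<bar>\<phi> x\<bar> powr r \<le> (1 / 2) powr r / J * G x powr s" for x
      proof -
        have "\<bar>\<phi> x\<bar> powr r \<le> (1 / 2 * (G x powr (s - 1) / J powr (1 / r))) powr r"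
          using r by (intro powr_mono2) (auto simp: \<phi>_def abs_mult abs_sgn_eq)
        also have "\<dots> = (1 / 2) powr r * ((G x powr (s - 1)) powr r / (J powr (1 / r)) powr r)"
          by (simp only: powr_mult powr_divide)
        also have "\<dots> = (1 / 2) powr r / J * G x powr s"
          using r J s by (simp add: powr_powr)
        finally show ?thesis .
      qed
      have "(\<integral>\<^sup>+x. ennreal (\<bar>\<phi> x\<bar> powr r) * indicator {-pi..pi} x \<partial>lebesgue)
          \<le> (\<integral>\<^sup>+x. ennreal ((1 / 2) powr r / J) * ennreal (G x powr s) \<partial>lebesgue)"
        using \<phi>r J by (intro nn_integral_mono) (auto simp: indicator_def ennreal_mult'[symmetric] intro!: ennreal_leI)
      also have "\<dots> = ennreal ((1 / 2) powr r / J) * ennreal J"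
        by (subst nn_integral_cmult) (auto simp: nnJ)
      also have "\<dots> = ennreal ((1 / 2) powr r)" using J by (simp flip: ennreal_mult')
      also have "\<dots> < 1"
      proof -
        have "(1 / 2) powr r < (1 / 2 :: real) powr 0" using r by (intro powr_less_mono') auto
        then show ?thesis by (simp add: ennreal_less_one_iff)
      qed
      finally have small: "(\<integral>\<^sup>+x. ennreal (\<bar>\<phi> x\<bar> powr r) * indicator {-pi..pi} x \<partial>lebesgue) < 1" .
      have "(LINT x:{-pi..pi}|lebesgue. u x * \<phi> x) \<le> D"
        by (rule duality_bounded[OF u dual _ _ \<phi>B small]) (use r in auto)
      also have "(LINT x:{-pi..pi}|lebesgue. u x * \<phi> x) = (LINT x|lebesgue. v x * \<phi> x)"
        by (simp add: set_lebesgue_integral_def v_def mult.assoc)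
      finally have le: "(LINT x|lebesgue. v x * \<phi> x) \<le> D" .
      \<comment> \<open>Because \<open>G x \<le> \<bar>v x\<bar>\<close>, pairing with
        \<open>\<phi>\<close> recovers at least this value; by conjugacy it equals
        \<open>J powr (1 / s) / 2\<close>.\<close>
      have "1 / (2 * J powr (1 / r)) * J = (LINT x|lebesgue. 1 / (2 * J powr (1 / r)) * G x powr s)"
        by (simp add: J_def)
      also have "\<dots> \<le> (LINT x|lebesgue. v x * \<phi> x)"
      proof (rule integral_mono)
        show "integrable lebesgue (\<lambda>x. 1 / (2 * J powr (1 / r)) * G x powr s)"
          by (intro integrable_mult_right intG)
        show "integrable lebesgue (\<lambda>x. v x * \<phi> x)"
        proof (rule Bochner_Integration.integrable_bound)
          show "integrable lebesgue (\<lambda>x. (real N powr (s - 1) / J powr (1 / r)) * v x)"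
            by (intro integrable_mult_right v)
          show "AE x in lebesgue. norm (v x * \<phi> x) \<le> norm (real N powr (s - 1) / J powr (1 / r) * v x)"
          proof (intro AE_I2)
            fix x
            show "norm (v x * \<phi> x) \<le> norm (real N powr (s - 1) / J powr (1 / r) * v x)"
              using mult_right_mono[OF \<phi>B[of x], of "\<bar>v x\<bar>"] by (simp add: abs_mult mult.commute)
          qed
        qed measurable
        fix x
        have "G x powr s = G x * G x powr (s - 1)"
          using G0(1)[of x] by (simp add: powr_mult_base)
        also have "\<dots> \<le> \<bar>v x\<bar> * G x powr (s - 1)"
          using G0 by (intro mult_right_mono) auto
        finally have "1 / (2 * J powr (1 / r)) * G x powr s \<le> 1 / (2 * J powr (1 / r)) * (\<bar>v x\<bar> * G x powr (s - 1))"
          by (intro mult_left_mono) auto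
        also have "\<dots> = v x * \<phi> x" by (simp add: \<phi>_def abs_sgn)
        finally show "1 / (2 * J powr (1 / r)) * G x powr s \<le> v x * \<phi> x" .
      qed
      also note le
      also have "1 / (2 * J powr (1 / r)) * J = J powr (1 / s) / 2"
        using J by (simp add: s(3)[symmetric] powr_diff)
      finally have "J powr (1 / s) \<le> 2 * D" by simp
      then have "(J powr (1 / s)) powr s \<le> (2 * D) powr s"
        using s by (intro powr_mono2) auto
      then show ?thesis using s J by (simp add: powr_powr)
    qed simp
    then show ?thesis using nnJ by (simp add: G_def ennreal_leI)
  qed
  have "(\<integral>\<^sup>+x. ennreal (\<bar>u x\<bar> powr s) * indicator {-pi..pi} x \<partial>lebesgue)
      = (\<integral>\<^sup>+x. liminf (\<lambda>N. ennreal (min \<bar>v x\<bar> (real N) powr s)) \<partial>lebesgue)"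
  proof (rule nn_integral_cong)
    fix x
    have "\<forall>\<^sub>F N in sequentially. real N \<ge> \<bar>v x\<bar>" by real_asymp
    then have "\<forall>\<^sub>F N in sequentially. ennreal (min \<bar>v x\<bar> (real N) powr s) = ennreal (\<bar>v x\<bar> powr s)"
      by eventually_elim (simp add: min_absorb1)
    then have "(\<lambda>N. ennreal (min \<bar>v x\<bar> (real N) powr s)) \<longlonglongrightarrow> ennreal (\<bar>v x\<bar> powr s)"
      by (rule tendsto_eventually)
    then have "liminf (\<lambda>N. ennreal (min \<bar>v x\<bar> (real N) powr s)) = ennreal (\<bar>v x\<bar> powr s)"
      by (intro lim_imp_Liminf) auto
    then show "ennreal (\<bar>u x\<bar> powr s) * indicator {-pi..pi} x = liminf (\<lambda>N. ennreal (min \<bar>v x\<bar> (real N) powr s))"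
      by (simp add: v_def indicator_def)
  qed
  also have "\<dots> \<le> liminf (\<lambda>N. \<integral>\<^sup>+x. ennreal (min \<bar>v x\<bar> (real N) powr s) \<partial>lebesgue)"
    by (intro nn_integral_liminf) measurable
  also have "\<dots> \<le> liminf (\<lambda>N. ennreal ((2 * D) powr s))"
    by (intro Liminf_mono always_eventually allI trunc)
  also have "\<dots> = ennreal ((2 * D) powr s)" by (simp add: Liminf_const)
  finally show ?thesis .
qed

section \<open>Fourier series and the remainder\<close>

lemma set_integrable_continuous_mult:
  fixes f w :: "real \<Rightarrow> real"
  assumes "set_integrable lebesgue {a..b} f" "continuous_on {a..b} w"
  shows "set_integrable lebesgue {a..b} (\<lambda>x. f x * w x)"
proof -
  have "(\<lambda>x. w x * f x) absolutely_integrable_on {a..b}"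
    using assms
    by (intro absolutely_integrable_bounded_measurable_product_real)
       (auto intro!: continuous_imp_measurable_on_sets_lebesgue compact_imp_bounded compact_continuous_image)
  then show ?thesis by (simp add: mult.commute)
qed

lemma LINT_cos_period:
  "(LINT x:{-pi..pi}|lebesgue. cos (of_int j * x + c)) = (if j = 0 then 2 * pi * cos c else 0)"
proof (cases "j = 0")
  case True
  then show ?thesis by (simp add: set_integral_const measure_def)
next
  case False
  define G where "G x = sin (of_int j * x + c) / of_int j" for x :: real
  have "((\<lambda>x. cos (of_int j * x + c)) has_integral (G pi - G (- pi))) {-pi..pi}"
    unfolding G_def using False
    by (intro fundamental_theorem_of_calculus)
       (auto intro!: derivative_eq_intros simp flip: has_real_derivative_iff_has_vector_derivative)
  moreover have "G pi - G (- pi) = 0"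
  proof -
    have "sin (of_int j * pi) = (0::real)" by (metis mult.commute sin_npi_int)
    then show ?thesis by (simp add: G_def sin_add sin_diff)
  qed
  moreover have "set_integrable lebesgue {-pi..pi} (\<lambda>x. cos (of_int j * x + c))"
    by (intro absolutely_integrable_continuous_real continuous_intros)
  ultimately show ?thesis using False
    by (simp add: set_lebesgue_integral_eq_integral integral_unique)
qed

lemma LINT_cos_cos:
  fixes k l :: nat
  shows "(LINT x:{-pi..pi}|lebesgue. cos (real k * x + a) * cos (real l * x + b)) =
    (if k = l then if k = 0 then 2 * pi * cos a * cos b else pi * cos (a - b) else 0)"
proof -
  have eq: "cos (real k * x + a) * cos (real l * x + b)
     = 1 / 2 * cos (of_int (int k - int l) * x + (a - b)) + 1 / 2 * cos (of_int (int k + int l) * x + (a + b))" for x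
  proof -
    have "(real k * x + a) - (real l * x + b) = of_int (int k - int l) * x + (a - b)"
      "(real k * x + a) + (real l * x + b) = of_int (int k + int l) * x + (a + b)"
      by (simp_all add: algebra_simps)
    then show ?thesis by (simp only: cos_times_cos) simp
  qed
  have "(LINT x:{-pi..pi}|lebesgue. cos (real k * x + a) * cos (real l * x + b))
      = 1 / 2 * (LINT x:{-pi..pi}|lebesgue. cos (of_int (int k - int l) * x + (a - b)))
        + 1 / 2 * (LINT x:{-pi..pi}|lebesgue. cos (of_int (int k + int l) * x + (a + b)))"
    unfolding eq
    by (subst set_integral_add(2))
       (auto intro!: absolutely_integrable_continuous_real continuous_intros)
  also have "\<dots> = (if k = l then if k = 0 then 2 * pi * cos a * cos b else pi * cos (a - b) else 0)"
    unfolding LINT_cos_period by (auto simp: cos_add cos_diff field_simps)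
  finally show ?thesis .
qed

lemma fourier_cos_phase:
  assumes "f \<in> Lper"
  shows "(LINT y:{-pi..pi}|lebesgue. f y * cos (real l * y + b))
    = pi * (fourier_a f l * cos b - fourier_b f l * sin b)"
proof -
  have f: "set_integrable lebesgue {-pi..pi} f" using assms by (simp add: Lper_def)
  have ab: "(LINT y:{-pi..pi}|lebesgue. f y * cos (real l * y)) = pi * fourier_a f l"
    "(LINT y:{-pi..pi}|lebesgue. f y * sin (real l * y)) = pi * fourier_b f l"
    by (simp_all add: fourier_a_def fourier_b_def)
  have "(LINT y:{-pi..pi}|lebesgue. f y * cos (real l * y + b))
      = (LINT y:{-pi..pi}|lebesgue. cos b * (f y * cos (real l * y)) - sin b * (f y * sin (real l * y)))"
    by (simp add: cos_add algebra_simps)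
  also have "\<dots> = cos b * (LINT y:{-pi..pi}|lebesgue. f y * cos (real l * y))
      - sin b * (LINT y:{-pi..pi}|lebesgue. f y * sin (real l * y))"
    by (subst set_integral_diff(2))
       (auto intro!: set_integrable_mult_right set_integrable_continuous_mult f continuous_intros)
  finally show ?thesis unfolding ab by (simp add: algebra_simps)
qed

lemma fourier_A_convolution:
  assumes "f \<in> Lper" "k \<ge> 1"
  shows "fourier_A k f x = 1 / pi * (LINT y:{-pi..pi}|lebesgue. f y * cos (real k * (x - y)))"
proof -
  have "cos (real k * (x - y)) = cos (real k * y + (- (real k * x)))" for y
    by (subst cos_minus[symmetric]) (simp add: algebra_simps)
  then show ?thesis using assms
    by (simp only: fourier_cos_phase[OF assms(1)]) (simp add: fourier_A_def)
qed

text \<open>For \<open>k = l\<close> this is the value that \<open>fourier_cos_phase\<close> gives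
  for \<open>f\<close> itself, so the two cancel. At index \<open>0\<close> the halved coefficient
  is offset by the integral \<open>2 * pi\<close> instead of \<open>pi\<close>.\<close>

lemma LINT_fourier_A_cos:
  "(LINT x:{-pi..pi}|lebesgue. fourier_A k f x * cos (real l * x + b))
    = (if k = l then pi * (fourier_a f l * cos b - fourier_b f l * sin b) else 0)"
proof -
  define a where "a = (if k = 0 then fourier_a f 0 / 2 else fourier_a f k)"
  define c where "c = (if k = 0 then 0 else fourier_b f k)"
  have "cos (real k * x + (- (pi / 2))) = sin (real k * x)" for x by (simp add: cos_diff)
  then have "fourier_A k f x * cos (real l * x + b) = a * (cos (real k * x + 0) * cos (real l * x + b))
      + c * (cos (real k * x + (- (pi / 2))) * cos (real l * x + b))" for x
    by (simp add: fourier_A_def a_def c_def distrib_right)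
  then have "(LINT x:{-pi..pi}|lebesgue. fourier_A k f x * cos (real l * x + b))
      = a * (LINT x:{-pi..pi}|lebesgue. cos (real k * x + 0) * cos (real l * x + b))
        + c * (LINT x:{-pi..pi}|lebesgue. cos (real k * x + (- (pi / 2))) * cos (real l * x + b))"
    by (simp only:, subst set_integral_add(2))
       (auto intro!: absolutely_integrable_continuous_real continuous_intros)
  also have "\<dots> = (if k = l then pi * (fourier_a f l * cos b - fourier_b f l * sin b) else 0)"
    unfolding LINT_cos_cos
    by (auto simp: a_def c_def fourier_b_def cos_diff algebra_simps)
  finally show ?thesis .
qed

lemma fourier_A_continuous [continuous_intros]: "continuous_on S (fourier_A k f)"
  unfolding fourier_A_def[abs_def] by (cases "k = 0") (auto intro!: continuous_intros)

text \<open>Orthogonality: once \<open>N\<close> reaches the degree of \<open>\<tau>\<close>, all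
  coefficients that \<open>\<tau>\<close> sees have been reproduced. This holds exactly and says
  nothing about convergence of the series.\<close>

lemma fourier_partial_sum_test:
  assumes f: "f \<in> Lper" and \<tau>: "trig_poly \<tau>"
  shows "\<exists>L. \<forall>N\<ge>L. (LINT x:{-pi..pi}|lebesgue. (f x - (\<Sum>k\<le>N. fourier_A k f x)) * \<tau> x) = 0"
  using \<tau>
proof (induction rule: trig_poly.induct)
  case (cos c l b)
  have fi: "set_integrable lebesgue {-pi..pi} f" using f by (simp add: Lper_def)
  have int: "set_integrable lebesgue {-pi..pi} (\<lambda>x. fourier_A k f x * cos (real l * x + b))" for k
    by (intro absolutely_integrable_continuous_real continuous_intros)
  have "(LINT x:{-pi..pi}|lebesgue. (f x - (\<Sum>k\<le>N. fourier_A k f x)) * (c * cos (real l * x + b))) = 0" if "N \<ge> l" for N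
  proof -
    have "(LINT x:{-pi..pi}|lebesgue. (f x - (\<Sum>k\<le>N. fourier_A k f x)) * (c * cos (real l * x + b)))
        = c * ((LINT x:{-pi..pi}|lebesgue. f x * cos (real l * x + b) - (\<Sum>k\<le>N. fourier_A k f x * cos (real l * x + b))))"
      by (subst set_integral_mult_right[symmetric]) (simp add: algebra_simps sum_distrib_left)
    also have "(LINT x:{-pi..pi}|lebesgue. f x * cos (real l * x + b) - (\<Sum>k\<le>N. fourier_A k f x * cos (real l * x + b)))
        = (LINT x:{-pi..pi}|lebesgue. f x * cos (real l * x + b))
          - (LINT x:{-pi..pi}|lebesgue. (\<Sum>k\<le>N. fourier_A k f x * cos (real l * x + b)))"
      by (intro set_integral_diff(2) set_integrable_continuous_mult fi continuous_intros
          absolutely_integrable_continuous_real)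
    also have "(LINT x:{-pi..pi}|lebesgue. (\<Sum>k\<le>N. fourier_A k f x * cos (real l * x + b)))
        = (\<Sum>k\<le>N. LINT x:{-pi..pi}|lebesgue. fourier_A k f x * cos (real l * x + b))"
      unfolding set_lebesgue_integral_def scaleR_sum_right
      using int by (intro Bochner_Integration.integral_sum) (simp add: set_integrable_def)
    also have "\<dots> = (LINT x:{-pi..pi}|lebesgue. f x * cos (real l * x + b))"
      using that by (simp add: LINT_fourier_A_cos fourier_cos_phase[OF f])
    finally show ?thesis by simp
  qed
  then show ?case by blast
next
  case (add \<sigma> \<rho>)
  then obtain L1 L2 where
    L1: "\<And>N. N \<ge> L1 \<Longrightarrow> (LINT x:{-pi..pi}|lebesgue. (f x - (\<Sum>k\<le>N. fourier_A k f x)) * \<sigma> x) = 0" and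
    L2: "\<And>N. N \<ge> L2 \<Longrightarrow> (LINT x:{-pi..pi}|lebesgue. (f x - (\<Sum>k\<le>N. fourier_A k f x)) * \<rho> x) = 0"
    by blast
  have "set_integrable lebesgue {-pi..pi} (\<lambda>x. f x - (\<Sum>k\<le>N. fourier_A k f x))" for N
    using f unfolding Lper_def
    by (intro set_integral_diff(1)) (auto intro!: absolutely_integrable_continuous_real continuous_intros)
  then have int: "set_integrable lebesgue {-pi..pi} (\<lambda>x. (f x - (\<Sum>k\<le>N. fourier_A k f x)) * w x)" if "trig_poly w" for w N
    by (rule set_integrable_continuous_mult[OF _ trig_poly_continuous[OF that]])
  have "(LINT x:{-pi..pi}|lebesgue. (f x - (\<Sum>k\<le>N. fourier_A k f x)) * (\<sigma> x + \<rho> x)) = 0" if "N \<ge> max L1 L2" for N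
    unfolding distrib_left
    by (subst set_integral_add(2)[OF int int]) (use add that L1 L2 in auto)
  then show ?case by blast
qed

text \<open>For a single harmonic the phase is a translation: evaluated at \<open>x'\<close> instead
  of \<open>x\<close>, the term of \<open>g\<close> becomes the term of \<open>f\<close> divided by
  \<open>\<psi> k\<close>. The translation depends on \<open>k\<close>, hence the treatment term by
  term.\<close>

lemma fourier_A_psi_beta_deriv:
  assumes d: "is_psi_beta_deriv \<psi> \<beta> f g" and k: "k \<ge> 1" "\<psi> k \<noteq> 0"
  shows "fourier_A k f x
    = \<psi> k * (1 / pi * (LINT y:{-pi..pi}|lebesgue. g y * cos (real k * (x - y) - \<beta> * pi / 2)))"
proof -
  have g: "g \<in> Lper" using d by (simp add: is_psi_beta_deriv_def)
  define x' where "x' = x - \<beta> * pi / 2 / real k"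
  have kx: "real k * x' = real k * x - \<beta> * pi / 2" using k by (simp add: x'_def algebra_simps)
  have "fourier_A k g x' = 1 / \<psi> k * (fourier_a f k * cos (real k * x' + \<beta> * pi / 2)
                 + fourier_b f k * sin (real k * x' + \<beta> * pi / 2))"
    using d k by (simp add: is_psi_beta_deriv_def)
  then have "fourier_A k f x = \<psi> k * fourier_A k g x'"
    using k by (simp add: kx fourier_A_def[of k f])
  also have "fourier_A k g x' = 1 / pi * (LINT y:{-pi..pi}|lebesgue. g y * cos (real k * (x' - y)))"
    by (rule fourier_A_convolution[OF g k(1)])
  finally show ?thesis unfolding right_diff_distrib kx by (simp add: algebra_simps)
qed

text \<open>The remainder keeps the fraction \<open>\<psi> n / \<psi> k\<close> of each harmonic
  with \<open>k < n\<close> and all of those from \<open>n\<close> to \<open>N\<close>. Expressing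
  harmonics of \<open>f\<close> through \<open>g\<close> brings a factor \<open>\<psi> k\<close>,
  which cancels the denominator.\<close>

lemma Zhat_remainder:
  assumes d: "is_psi_beta_deriv \<psi> \<beta> f g" and \<psi>: "\<forall>k\<ge>1. \<psi> k \<noteq> 0" and n: "1 \<le> n" "n \<le> N"
  shows "(\<Sum>k\<le>N. fourier_A k f x) - Zhat \<psi> n f x
    = 1 / pi * (LINT y:{-pi..pi}|lebesgue. g y *
        (\<Sum>k\<in>{1..N}. (if k < n then \<psi> n else \<psi> k) * cos (real k * (x - y) - \<beta> * pi / 2)))"
proof -
  define m where "m k = (if k < n then \<psi> n else \<psi> k)" for k
  have g: "set_integrable lebesgue {-pi..pi} g"
    using d by (simp add: is_psi_beta_deriv_def Lper_def)
  have "(\<Sum>k\<le>N. fourier_A k f x) - Zhat \<psi> n f x = (\<Sum>k\<in>{1..N}. m k / \<psi> k * fourier_A k f x)"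
  proof -
    have "{..N} = insert 0 ({1..<n} \<union> {n..N})" and N: "{1..N} = {1..<n} \<union> {n..N}" using n by auto
    have U: "sum h ({Suc 0..<n} \<union> {n..N}) = sum h {Suc 0..<n} + sum h {n..N}" for h :: "nat \<Rightarrow> real"
      by (rule sum.union_disjoint) auto
    from \<open>{..N} = _\<close> have "(\<Sum>k\<le>N. fourier_A k f x) = fourier_A 0 f x + ((\<Sum>k\<in>{1..<n}. fourier_A k f x) + (\<Sum>k\<in>{n..N}. fourier_A k f x))"
      using n by (simp add: U)
    moreover have "Zhat \<psi> n f x = fourier_A 0 f x
        + ((\<Sum>k\<in>{1..<n}. fourier_A k f x) - (\<Sum>k\<in>{1..<n}. m k / \<psi> k * fourier_A k f x))"
      by (simp add: Zhat_def m_def fourier_A_def[of 0] left_diff_distrib sum_subtractf)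
    moreover have "(\<Sum>k\<in>{n..N}. m k / \<psi> k * fourier_A k f x) = (\<Sum>k\<in>{n..N}. fourier_A k f x)"
      using \<psi> n by (intro sum.cong) (auto simp: m_def)
    ultimately show ?thesis unfolding N by (simp add: U)
  qed
  also have "\<dots> = (\<Sum>k\<in>{1..N}. 1 / pi * (LINT y:{-pi..pi}|lebesgue. g y * (m k * cos (real k * (x - y) - \<beta> * pi / 2))))"
  proof (intro sum.cong refl)
    fix k assume k: "k \<in> {1..N}"
    have "m k / \<psi> k * fourier_A k f x
        = m k * (1 / pi * (LINT y:{-pi..pi}|lebesgue. g y * cos (real k * (x - y) - \<beta> * pi / 2)))"
      using k \<psi> by (subst fourier_A_psi_beta_deriv[OF d]) auto
    also have "\<dots> = 1 / pi * (LINT y:{-pi..pi}|lebesgue. m k * (g y * cos (real k * (x - y) - \<beta> * pi / 2)))"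
      by (subst set_integral_mult_right) simp
    finally show "m k / \<psi> k * fourier_A k f x = 1 / pi * (LINT y:{-pi..pi}|lebesgue. g y * (m k * cos (real k * (x - y) - \<beta> * pi / 2)))"
      by (simp add: mult.left_commute)
  qed
  also have "\<dots> = 1 / pi * (\<Sum>k\<in>{1..N}. LINT y:{-pi..pi}|lebesgue. g y * (m k * cos (real k * (x - y) - \<beta> * pi / 2)))"
    by (rule sum_distrib_left[symmetric])
  also have "(\<Sum>k\<in>{1..N}. LINT y:{-pi..pi}|lebesgue. g y * (m k * cos (real k * (x - y) - \<beta> * pi / 2)))
      = (LINT y:{-pi..pi}|lebesgue. \<Sum>k\<in>{1..N}. g y * (m k * cos (real k * (x - y) - \<beta> * pi / 2)))"
  proof -
    have "set_integrable lebesgue {-pi..pi} (\<lambda>y. g y * (m k * cos (real k * (x - y) - \<beta> * pi / 2)))" for k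
      by (intro set_integrable_continuous_mult[OF g] continuous_intros)
    then show ?thesis
      unfolding set_lebesgue_integral_def scaleR_sum_right set_integrable_def
      by (intro Bochner_Integration.integral_sum[symmetric])
  qed
  finally show ?thesis by (simp add: m_def sum_distrib_left)
qed

text \<open>The kernel bound is a power of \<open>\<bar>sin (t / 2)\<bar>\<close>, dominated by
  three translates of the Riesz kernel, so the bilinear inequality is applied with the shifts
  \<open>0\<close>, \<open>2 * pi\<close> and \<open>- 2 * pi\<close>. Since \<open>g\<close>
  carries the exponent \<open>p\<close>, it takes the place of the first function there, and
  Tonelli's theorem restores the order of integration.\<close>

lemma multiplier_bilinear_bound:
  fixes \<alpha> p r :: real
  assumes \<alpha>: "0 < \<alpha>" "\<alpha> < 1" and p: "1 < p" and r: "1 < r" and pr: "1 / p + 1 / r = 1 + \<alpha>"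
  obtains C :: real where "C > 0"
    "\<And>l m M g \<tau> N \<theta>. (\<And>k. k \<ge> 1 \<Longrightarrow> \<bar>l k\<bar> \<le> M) \<Longrightarrow>
      (\<And>j. j \<ge> 1 \<Longrightarrow> (\<Sum>k\<in>{2 ^ j..2 ^ (j + 1)}. \<bar>l (k + 1) - l k\<bar>) \<le> M) \<Longrightarrow>
      (\<And>k::nat. k \<ge> 1 \<Longrightarrow> m k = real k powr (- \<alpha>) * l k) \<Longrightarrow>
      g \<in> borel_measurable lebesgue \<Longrightarrow> \<tau> \<in> borel_measurable borel \<Longrightarrow>
      (\<integral>\<^sup>+y. ennreal (\<bar>g y\<bar> powr p) * indicator {-pi..pi} y \<partial>lebesgue) \<le> 1 \<Longrightarrow>
      (\<integral>\<^sup>+x. ennreal (\<bar>\<tau> x\<bar> powr r) * indicator {-pi..pi} x \<partial>lebesgue) \<le> 1 \<Longrightarrow>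
      (\<integral>\<^sup>+x. \<integral>\<^sup>+y. ennreal (\<bar>\<tau> x\<bar> * \<bar>g y\<bar> * \<bar>\<Sum>k\<in>{1..N}. m k * cos (real k * (x - y) - \<theta>)\<bar>)
          * indicator ({-pi..pi} \<times> {-pi..pi}) (x, y) \<partial>lebesgue \<partial>lebesgue) \<le> ennreal (C * M)"
proof -
  obtain K where K: "K > 0" and kern: "\<And>m l M N t \<theta>. (\<And>k. k \<ge> 1 \<Longrightarrow> \<bar>l k\<bar> \<le> M) \<Longrightarrow>
      (\<And>j. j \<ge> 1 \<Longrightarrow> (\<Sum>k\<in>{2 ^ j..2 ^ (j + 1)}. \<bar>l (k + 1) - l k\<bar>) \<le> M) \<Longrightarrow>
      (\<And>k::nat. k \<ge> 1 \<Longrightarrow> m k = real k powr (- \<alpha>) * l k) \<Longrightarrow> sin (t / 2) \<noteq> 0 \<Longrightarrow>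
      \<bar>\<Sum>k\<in>{1..N}. m k * cos (real k * t - \<theta>)\<bar> \<le> K * M * \<bar>sin (t / 2)\<bar> powr (\<alpha> - 1)"
    by (fact multiplier_kernel_bound[OF \<alpha>])
  obtain H where H: "H > 0" and hls: "\<And>f h c. f \<in> borel_measurable borel \<Longrightarrow> h \<in> borel_measurable borel \<Longrightarrow>
       (\<And>x. 0 \<le> f x) \<Longrightarrow> (\<And>y. 0 \<le> h y) \<Longrightarrow>
       (\<integral>\<^sup>+x. ennreal (f x powr p) \<partial>lborel) \<le> 1 \<Longrightarrow> (\<integral>\<^sup>+y. ennreal (h y powr r) \<partial>lborel) \<le> 1 \<Longrightarrow>
       (\<integral>\<^sup>+x. \<integral>\<^sup>+y. ennreal (f x * h y * \<bar>x - c - y\<bar> powr (\<alpha> - 1)) \<partial>lborel \<partial>lborel) \<le> ennreal H"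
    by (fact hardy_littlewood_sobolev_bilinear[OF \<alpha>(1) p r pr])
  define P where "P = pi powr (1 - \<alpha>)"
  \<comment> \<open>\<open>P\<close> is the constant of \<open>abs_sin_half_powr_le\<close>; the
    \<open>3\<close> counts the shifts.\<close>
  define C where "C = K * P * (3 * H)"
  have "C > 0" using K H by (simp add: C_def P_def)
  moreover have "(\<integral>\<^sup>+x. \<integral>\<^sup>+y. ennreal (\<bar>\<tau> x\<bar> * \<bar>g y\<bar> * \<bar>\<Sum>k\<in>{1..N}. m k * cos (real k * (x - y) - \<theta>)\<bar>)
          * indicator ({-pi..pi} \<times> {-pi..pi}) (x, y) \<partial>lebesgue \<partial>lebesgue) \<le> ennreal (C * M)"
    if l: "\<And>k. k \<ge> 1 \<Longrightarrow> \<bar>l k\<bar> \<le> M"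
     and var: "\<And>j. j \<ge> 1 \<Longrightarrow> (\<Sum>k\<in>{2 ^ j..2 ^ (j + 1)}. \<bar>l (k + 1) - l k\<bar>) \<le> M"
     and m: "\<And>k::nat. k \<ge> 1 \<Longrightarrow> m k = real k powr (- \<alpha>) * l k"
     and g: "g \<in> borel_measurable lebesgue" and \<tau>[measurable]: "\<tau> \<in> borel_measurable borel"
     and gp: "(\<integral>\<^sup>+y. ennreal (\<bar>g y\<bar> powr p) * indicator {-pi..pi} y \<partial>lebesgue) \<le> 1"
     and \<tau>r: "(\<integral>\<^sup>+x. ennreal (\<bar>\<tau> x\<bar> powr r) * indicator {-pi..pi} x \<partial>lebesgue) \<le> 1"
    for l m M g \<tau> N \<theta>
  proof -
    have M: "M \<ge> 0" using l[of 1] by simp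
    \<comment> \<open>The bilinear inequality is stated for Borel functions, whereas
      \<open>g\<close> is only Lebesgue measurable.\<close>
    obtain g' where [measurable]: "g' \<in> borel_measurable borel" and g': "AE y in lebesgue. g y = g' y"
      using completion_ex_borel_measurable_real[of g lborel] g by (auto simp: AE_completion_iff)
    define f where "f y = \<bar>g' y\<bar> * indicator {-pi..pi} y" for y
    define h where "h x = \<bar>\<tau> x\<bar> * indicator {-pi..pi} x" for x
    have [measurable]: "f \<in> borel_measurable borel" "h \<in> borel_measurable borel"
      unfolding f_def h_def by measurable
    have f0: "f y \<ge> 0" and h0: "h y \<ge> 0" for y by (auto simp: f_def h_def)
    have fp: "(\<integral>\<^sup>+y. ennreal (f y powr p) \<partial>lborel) \<le> 1"
    proof -
      have "(\<integral>\<^sup>+y. ennreal (f y powr p) \<partial>lborel) = (\<integral>\<^sup>+y. ennreal (f y powr p) \<partial>lebesgue)"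
        by (simp add: nn_integral_completion)
      also have "\<dots> = (\<integral>\<^sup>+y. ennreal (\<bar>g y\<bar> powr p) * indicator {-pi..pi} y \<partial>lebesgue)"
        using g' by (intro nn_integral_cong_AE) (auto elim!: eventually_mono simp: f_def indicator_def)
      finally show ?thesis using gp by simp
    qed
    have hr: "(\<integral>\<^sup>+x. ennreal (h x powr r) \<partial>lborel) \<le> 1"
    proof -
      have "(\<integral>\<^sup>+x. ennreal (h x powr r) \<partial>lborel) = (\<integral>\<^sup>+x. ennreal (\<bar>\<tau> x\<bar> powr r) * indicator {-pi..pi} x \<partial>lborel)"
        by (intro nn_integral_cong) (auto simp: h_def indicator_def)
      then show ?thesis using \<tau>r by (simp add: nn_integral_completion)
    qed
    define W where "W c x y = ennreal (f y * h x * \<bar>y - c - x\<bar> powr (\<alpha> - 1))" for c x y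
    have [measurable]: "case_prod (W c) \<in> borel_measurable (borel \<Otimes>\<^sub>M borel)" for c
      unfolding W_def by measurable
    have [measurable]: "W c x \<in> borel_measurable borel" for c x
      unfolding W_def by measurable
    have Wint: "(\<integral>\<^sup>+x. \<integral>\<^sup>+y. W c x y \<partial>lborel \<partial>lborel) \<le> ennreal H" for c
    proof -
      have "(\<integral>\<^sup>+x. \<integral>\<^sup>+y. W c x y \<partial>lborel \<partial>lborel) = (\<integral>\<^sup>+y. \<integral>\<^sup>+x. W c x y \<partial>lborel \<partial>lborel)"
        by (rule lborel_pair.Fubini'[symmetric]) measurable
      also have "\<dots> \<le> ennreal H" unfolding W_def by (rule hls[OF _ _ f0 h0 fp hr]) measurable
      finally show ?thesis .
    qed
    \<comment> \<open>At the three excluded values of \<open>y\<close> the sine vanishes and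
      \<open>0 powr (\<alpha> - 1)\<close> is \<open>0\<close>, so the kernel bound may fail there;
      for each \<open>x\<close> they form a null set.\<close>
    have ptw: "ennreal (\<bar>\<tau> x\<bar> * \<bar>g y\<bar> * \<bar>\<Sum>k\<in>{1..N}. m k * cos (real k * (x - y) - \<theta>)\<bar>)
          * indicator ({-pi..pi} \<times> {-pi..pi}) (x, y)
        \<le> ennreal (K * M * P) * (W 0 x y + (W (2 * pi) x y + W (- 2 * pi) x y))"
      if gy: "g y = g' y" and y: "y \<noteq> x" "y \<noteq> x - 2 * pi" "y \<noteq> x + 2 * pi" for x y
    proof (cases "(x, y) \<in> {-pi..pi} \<times> {-pi..pi}")
      case True
      define t where "t = x - y"
      have t: "\<bar>t\<bar> \<le> 2 * pi" using True by (auto simp: t_def)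
      have sin: "sin (t / 2) \<noteq> 0"
      proof -
        have "t \<noteq> 0" "- 2 * pi < t" "t < 2 * pi" using y t by (auto simp: t_def abs_le_iff)
        then show ?thesis using sin_gt_zero[of "t / 2"] sin_gt_zero[of "- t / 2"]
          by (cases "t > 0") auto
      qed
      define S where "S = \<bar>t\<bar> powr (\<alpha> - 1) + \<bar>t - 2 * pi\<bar> powr (\<alpha> - 1) + \<bar>t + 2 * pi\<bar> powr (\<alpha> - 1)"
      have "\<bar>\<Sum>k\<in>{1..N}. m k * cos (real k * t - \<theta>)\<bar> \<le> K * M * \<bar>sin (t / 2)\<bar> powr (\<alpha> - 1)"
        by (rule kern[OF l var m sin])
      also have "\<dots> \<le> K * M * (P * S)"
        using abs_sin_half_powr_le[of "\<alpha> - 1" t] \<alpha> t sin K M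
        by (intro mult_left_mono) (auto simp: P_def S_def)
      finally have "\<bar>\<tau> x\<bar> * \<bar>g y\<bar> * \<bar>\<Sum>k\<in>{1..N}. m k * cos (real k * t - \<theta>)\<bar> \<le> \<bar>\<tau> x\<bar> * \<bar>g y\<bar> * (K * M * (P * S))"
        by (intro mult_left_mono) auto
      also have "\<dots> = K * M * P * (f y * h x * \<bar>y - 0 - x\<bar> powr (\<alpha> - 1)
          + (f y * h x * \<bar>y - 2 * pi - x\<bar> powr (\<alpha> - 1) + f y * h x * \<bar>y - - 2 * pi - x\<bar> powr (\<alpha> - 1)))"
      proof -
        have "\<bar>y - 0 - x\<bar> = \<bar>t\<bar>" "\<bar>y - 2 * pi - x\<bar> = \<bar>t + 2 * pi\<bar>" "\<bar>y - - 2 * pi - x\<bar> = \<bar>t - 2 * pi\<bar>"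
          by (auto simp: t_def)
        moreover have "f y = \<bar>g y\<bar>" "h x = \<bar>\<tau> x\<bar>" using True gy by (auto simp: f_def h_def)
        ultimately show ?thesis by (simp only: S_def) (simp add: algebra_simps)
      qed
      finally have "ennreal (\<bar>\<tau> x\<bar> * \<bar>g y\<bar> * \<bar>\<Sum>k\<in>{1..N}. m k * cos (real k * t - \<theta>)\<bar>)
          \<le> ennreal (K * M * P * (f y * h x * \<bar>y - 0 - x\<bar> powr (\<alpha> - 1)
          + (f y * h x * \<bar>y - 2 * pi - x\<bar> powr (\<alpha> - 1) + f y * h x * \<bar>y - - 2 * pi - x\<bar> powr (\<alpha> - 1))))"
        by (rule ennreal_leI)
      also have "\<dots> = ennreal (K * M * P) * (W 0 x y + (W (2 * pi) x y + W (- 2 * pi) x y))"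
        unfolding W_def using K M f0[of y] h0[of x]
        by (subst ennreal_mult) (auto simp: P_def ennreal_plus)
      finally show ?thesis using True by (simp add: t_def)
    qed simp
    have "(\<integral>\<^sup>+x. \<integral>\<^sup>+y. ennreal (\<bar>\<tau> x\<bar> * \<bar>g y\<bar> * \<bar>\<Sum>k\<in>{1..N}. m k * cos (real k * (x - y) - \<theta>)\<bar>)
          * indicator ({-pi..pi} \<times> {-pi..pi}) (x, y) \<partial>lebesgue \<partial>lebesgue)
        \<le> (\<integral>\<^sup>+x. \<integral>\<^sup>+y. ennreal (K * M * P) * (W 0 x y + (W (2 * pi) x y + W (- 2 * pi) x y)) \<partial>lebesgue \<partial>lebesgue)"
    proof (rule nn_integral_mono, rule nn_integral_mono_AE)
      fix x :: real
      have "AE y in lebesgue. y \<notin> {x, x - 2 * pi, x + 2 * pi}"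
        by (intro AE_not_in) (simp flip: negligible_iff_null_sets)
      with g' show "AE y in lebesgue. ennreal (\<bar>\<tau> x\<bar> * \<bar>g y\<bar> * \<bar>\<Sum>k\<in>{1..N}. m k * cos (real k * (x - y) - \<theta>)\<bar>)
          * indicator ({-pi..pi} \<times> {-pi..pi}) (x, y)
        \<le> ennreal (K * M * P) * (W 0 x y + (W (2 * pi) x y + W (- 2 * pi) x y))"
        by eventually_elim (rule ptw, auto)
    qed
    also have "\<dots> = (\<integral>\<^sup>+x. ennreal (K * M * P) * ((\<integral>\<^sup>+y. W 0 x y \<partial>lborel) + ((\<integral>\<^sup>+y. W (2 * pi) x y \<partial>lborel) + (\<integral>\<^sup>+y. W (- 2 * pi) x y \<partial>lborel))) \<partial>lborel)"
      by (simp add: nn_integral_completion nn_integral_cmult nn_integral_add)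
    also have "\<dots> = ennreal (K * M * P) * ((\<integral>\<^sup>+x. \<integral>\<^sup>+y. W 0 x y \<partial>lborel \<partial>lborel) + ((\<integral>\<^sup>+x. \<integral>\<^sup>+y. W (2 * pi) x y \<partial>lborel \<partial>lborel)
         + (\<integral>\<^sup>+x. \<integral>\<^sup>+y. W (- 2 * pi) x y \<partial>lborel \<partial>lborel)))"
      by (simp add: nn_integral_cmult nn_integral_add)
    also have "\<dots> \<le> ennreal (K * M * P) * (ennreal H + (ennreal H + ennreal H))"
      by (intro mult_left_mono add_mono Wint) simp
    also have "\<dots> = ennreal (C * M)"
      using H K M by (simp add: C_def P_def algebra_simps flip: ennreal_plus ennreal_mult)
    finally show ?thesis .
  qed
  ultimately show thesis using that by blast
qed

section \<open>Variable exponents\<close>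

lemma lebesgue_AE_exists:
  assumes "AE x in lebesgue. P x" and "(a::real) < b"
  shows "\<exists>x\<in>{a..b}. P x"
proof (rule ccontr)
  assume "\<not> ?thesis"
  with assms(1) have "AE x in lebesgue. x \<notin> {a..b}" by (auto elim: eventually_mono)
  then have "{a..b} \<in> null_sets lebesgue" by (subst AE_iff_null_sets) auto
  then have "emeasure lebesgue {a..b} = 0" by (simp add: null_setsD1)
  then show False using assms(2) by simp
qed

lemma nn_integral_period_const:
  "c \<ge> 0 \<Longrightarrow> (\<integral>\<^sup>+x. ennreal c * indicator {-pi..pi} x \<partial>lebesgue) = ennreal (2 * pi * c)"
  by (subst nn_integral_cmult_indicator) (auto simp: ennreal_mult'[symmetric] mult.commute)

lemma periodic_2pi_reduce:
  assumes "periodic_2pi f"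
  shows "\<exists>y\<in>{-pi..pi}. f x = f y"
proof -
  interpret periodic_fun_simple f "2 * pi"
    by unfold_locales (use assms in \<open>simp add: periodic_2pi_def\<close>)
  define n where "n = - \<lfloor>(x + pi) / (2 * pi)\<rfloor>"
  have "real_of_int n * (2 * pi) + x \<in> {-pi..pi}"
  proof -
    define z where "z = (x + pi) / (2 * pi)"
    have z: "x + pi = z * (2 * pi)" by (simp add: z_def)
    have "real_of_int \<lfloor>z\<rfloor> * (2 * pi) \<le> z * (2 * pi)" "z * (2 * pi) \<le> (real_of_int \<lfloor>z\<rfloor> + 1) * (2 * pi)"
      by (intro mult_right_mono; simp)+
    then have "real_of_int \<lfloor>z\<rfloor> * (2 * pi) \<le> x + pi" "x + pi \<le> (real_of_int \<lfloor>z\<rfloor> + 1) * (2 * pi)"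
      by (simp_all only: z)
    then show ?thesis by (simp add: n_def z_def[symmetric] distrib_right)
  qed
  moreover have "f x = f (real_of_int n * (2 * pi) + x)"
    using plus_of_int[of x n] by (simp add: add.commute)
  ultimately show ?thesis by blast
qed

text \<open>At \<open>\<delta> = exp (- L)\<close> the logarithm is \<open>L\<close>, so the
  oscillation is at most \<open>K / L powr \<gamma>\<close>, hence at most \<open>K / L\<close> when
  \<open>L \<ge> 1\<close>; the choice \<open>L = K / e + 1\<close> makes this less than
  \<open>e\<close>.\<close>

lemma dini_lipschitz_continuous:
  assumes "dini_lipschitz \<gamma> p" "\<gamma> \<ge> 1"
  shows "continuous_on {-pi..pi} p"
proof -
  obtain K0 where K0: "\<And>\<delta>. 0 < \<delta> \<Longrightarrow> \<delta> < 1 \<Longrightarrow>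
     modulus_cont p \<delta> * ennreal (ln (1 / \<delta>) powr \<gamma>) \<le> ennreal K0"
    using assms(1) unfolding dini_lipschitz_def by blast
  \<comment> \<open>A negative \<open>K0\<close> is possible, since \<open>ennreal\<close> maps it
    to \<open>0\<close>.\<close>
  define K where "K = max K0 0"
  have "K \<ge> 0" by (simp add: K_def)
  show ?thesis
  proof (rule uniformly_continuous_imp_continuous, unfold uniformly_continuous_on_def, intro allI impI)
    fix e :: real assume "e > 0"
    define L where "L = K / e + 1"
    have L: "L \<ge> 1" using \<open>K \<ge> 0\<close> \<open>e > 0\<close> by (simp add: L_def)
    have "\<bar>p x - p y\<bar> < e" if "x \<in> {-pi..pi}" "y \<in> {-pi..pi}" "\<bar>x - y\<bar> \<le> exp (- L)" for x y
    proof -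
      have "ennreal \<bar>p x - p y\<bar> \<le> modulus_cont p (exp (- L))"
        unfolding modulus_cont_def using that by (intro SUP_upper2[of "(x, y)"]) auto
      then have "ennreal \<bar>p x - p y\<bar> * ennreal (ln (1 / exp (- L)) powr \<gamma>)
          \<le> modulus_cont p (exp (- L)) * ennreal (ln (1 / exp (- L)) powr \<gamma>)"
        by (rule mult_right_mono) simp
      also have "\<dots> \<le> ennreal K0" using L by (intro K0) auto
      also have "\<dots> \<le> ennreal K" by (simp add: K_def ennreal_leI)
      also have "ln (1 / exp (- L)) = L" by (simp add: ln_div)
      finally have "ennreal (\<bar>p x - p y\<bar> * L powr \<gamma>) \<le> ennreal K"
        by (simp add: ennreal_mult)
      then have "\<bar>p x - p y\<bar> * L powr \<gamma> \<le> K" using \<open>K \<ge> 0\<close> by simp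
      moreover have "\<bar>p x - p y\<bar> * L \<le> \<bar>p x - p y\<bar> * L powr \<gamma>"
        using powr_mono[of 1 \<gamma> L] L assms(2) by (intro mult_left_mono) auto
      moreover have "K < e * L" using \<open>e > 0\<close> by (simp add: L_def field_simps)
      ultimately have "\<bar>p x - p y\<bar> * L < e * L" by linarith
      then show ?thesis using L by simp
    qed
    then show "\<exists>d>0. \<forall>x\<in>{-pi..pi}. \<forall>x'\<in>{-pi..pi}. dist x' x < d \<longrightarrow> dist (p x') (p x) < e"
      by (intro exI[of _ "exp (- L)"]) (auto simp: dist_real_def)
  qed
qed

text \<open>Pointwise \<open>p x > 1\<close> would still allow the infimum \<open>1\<close>. By
  continuity the minimum over a closed period is attained, and periodicity carries it to the whole
  line, so the lower exponent is strictly above \<open>1\<close>.\<close>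

lemma DL_exponents_bounds:
  assumes p: "p \<in> DL_exponents \<gamma>" and "\<gamma> \<ge> 1"
  shows "exp_lower p > 1" "AE x in lebesgue. exp_lower p \<le> p x" "AE x in lebesgue. p x \<le> exp_upper p"
proof -
  have p1: "\<And>x. p x > 1" and [measurable]: "p \<in> borel_measurable lebesgue"
    and per: "periodic_2pi p" and "dini_lipschitz \<gamma> p"
    using p by (auto simp: DL_exponents_def exponent_def)
  obtain B where B: "AE x in lebesgue. \<bar>p x\<bar> \<le> B"
    using p by (auto simp: DL_exponents_def exponent_def)
  have "continuous_on {-pi..pi} p"
    using \<open>dini_lipschitz \<gamma> p\<close> assms(2) by (rule dini_lipschitz_continuous)
  then obtain x0 where x0: "\<forall>x\<in>{-pi..pi}. p x0 \<le> p x"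
    using continuous_attains_inf[of "{-pi..pi}" p] by fastforce
  have c: "p x0 \<le> p x" for x
    using periodic_2pi_reduce[OF per, of x] x0 by metis
  \<comment> \<open>\<open>real_of_ereal\<close> sends infinite values to \<open>0\<close>, so both
    essential suprema must first be shown finite: an almost everywhere bound gives one side, a point
    at which the defining inequality holds gives the other.\<close>
  define E where "E = esssup lebesgue (\<lambda>x. ereal \<bar>p x\<bar>)"
  define F where "F = esssup lebesgue (\<lambda>x. - ereal \<bar>p x\<bar>)"
  have E_AE: "AE x in lebesgue. ereal \<bar>p x\<bar> \<le> E" unfolding E_def by (rule esssup_AE)
  have F_AE: "AE x in lebesgue. - ereal \<bar>p x\<bar> \<le> F" unfolding F_def by (rule esssup_AE)
  have "E \<le> ereal B" unfolding E_def using B by (intro esssup_I) auto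
  moreover obtain x1 where "ereal \<bar>p x1\<bar> \<le> E" using lebesgue_AE_exists[OF E_AE, of 0 1] by auto
  ultimately have E: "E = ereal (exp_upper p)"
    unfolding exp_upper_def E_def[symmetric] by (cases E) auto
  have Fle: "F \<le> - ereal (p x0)"
  proof -
    have "p x0 \<le> \<bar>p x\<bar>" for x using c[of x] by linarith
    then show ?thesis unfolding F_def by (intro esssup_I) auto
  qed
  moreover obtain x2 where "- ereal \<bar>p x2\<bar> \<le> F" using lebesgue_AE_exists[OF F_AE, of 0 1] by auto
  ultimately have F: "F = - ereal (exp_lower p)"
    unfolding exp_lower_def F_def[symmetric] by (cases F) auto
  show "exp_lower p > 1" using Fle p1[of x0] unfolding F by simp
  show "AE x in lebesgue. p x \<le> exp_upper p"
    using E_AE unfolding E by (rule eventually_mono) auto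
  show "AE x in lebesgue. exp_lower p \<le> p x"
    using F_AE unfolding F
  proof (rule eventually_mono)
    fix x assume "- ereal \<bar>p x\<bar> \<le> - ereal (exp_lower p)"
    then show "exp_lower p \<le> p x" using p1[of x] by simp
  qed
qed

text \<open>Pointwise \<open>t powr p0 \<le> 1 + t powr p x\<close>, by cases at
  \<open>t = 1\<close>. Integrated over the period the right side is at most
  \<open>2 * pi + 1\<close>, and dividing the function by this number, with an exponent at least
  \<open>1\<close>, restores the bound \<open>1\<close>.\<close>

lemma var_norm_le_imp_lower_power:
  assumes [measurable]: "g \<in> borel_measurable lebesgue" "p \<in> borel_measurable lebesgue"
    and "var_norm p g \<le> 1"
    and p0: "1 \<le> p0" "AE x in lebesgue. p0 \<le> p x"
  shows "(\<integral>\<^sup>+x. ennreal (\<bar>g x / (2 * (2 * pi + 1))\<bar> powr p0) * indicator {-pi..pi} x \<partial>lebesgue) \<le> 1"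
proof -
  define q where "q = 2 * pi + 1"
  have q: "q > 1" by (simp add: q_def)
  \<comment> \<open>The infimum defining the norm need not be attained; relaxing \<open>1\<close> to
    \<open>2\<close> provides an admissible \<open>a\<close>, and this is the factor
    \<open>2\<close> in the statement.\<close>
  have "var_norm p g < 2" using assms(3) by (rule order_le_less_trans) simp
  then obtain a where a: "a > 0" "var_modular p (\<lambda>x. g x / a) \<le> 1" "ennreal a < 2"
    unfolding var_norm_def INF_less_iff by auto
  have "a < 2" using a by (simp add: ennreal_less_iff flip: ennreal_numeral)
  have [measurable]: "{-pi..pi} \<in> sets lebesgue" by simp
  have "(\<integral>\<^sup>+x. ennreal (\<bar>g x / (2 * q)\<bar> powr p0) * indicator {-pi..pi} x \<partial>lebesgue)
      \<le> (\<integral>\<^sup>+x. ennreal (1 / q) * (ennreal 1 * indicator {-pi..pi} x + ennreal (\<bar>g x / a\<bar> powr p x) * indicator {-pi..pi} x) \<partial>lebesgue)"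
  proof (rule nn_integral_mono_AE)
    show "AE x in lebesgue. ennreal (\<bar>g x / (2 * q)\<bar> powr p0) * indicator {-pi..pi} x
      \<le> ennreal (1 / q) * (ennreal 1 * indicator {-pi..pi} x + ennreal (\<bar>g x / a\<bar> powr p x) * indicator {-pi..pi} x)"
      using p0(2)
    proof eventually_elim
      case (elim x)
      define t where "t = \<bar>g x / a\<bar>"
      have "a * \<bar>g x\<bar> \<le> 2 * \<bar>g x\<bar>" using \<open>a < 2\<close> by (intro mult_right_mono) auto
      then have "\<bar>g x / (2 * q)\<bar> \<le> t / q"
        using a q by (simp add: t_def field_simps)
      then have "\<bar>g x / (2 * q)\<bar> powr p0 \<le> (t / q) powr p0" using p0 by (intro powr_mono2) auto
      also have "\<dots> = t powr p0 / q powr p0" by (rule powr_divide)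
      also have "\<dots> \<le> t powr p0 / q"
        using powr_mono[of 1 p0 q] p0 q by (intro divide_left_mono) auto
      also have "t powr p0 \<le> 1 + t powr p x"
      proof (cases "t \<le> 1")
        case True
        then have "t powr p0 \<le> 1 powr p0" using p0 by (intro powr_mono2) (auto simp: t_def)
        then have "t powr p0 \<le> 1" by simp
        then show ?thesis using powr_ge_zero[of t "p x"] by linarith
      next
        case False
        then have "t powr p0 \<le> t powr p x" using elim by (intro powr_mono) auto
        then show ?thesis by simp
      qed
      finally have "\<bar>g x / (2 * q)\<bar> powr p0 \<le> 1 / q * (1 + t powr p x)"
        using q by (simp add: divide_right_mono)
      then have "ennreal (\<bar>g x / (2 * q)\<bar> powr p0) \<le> ennreal (1 / q * (1 + t powr p x))"
        by (rule ennreal_leI)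
      also have "\<dots> = ennreal (1 / q) * (ennreal 1 + ennreal (t powr p x))"
        using q by (subst ennreal_mult) (auto simp: ennreal_plus)
      finally show ?case by (simp add: t_def indicator_def)
    qed
  qed
  also have "\<dots> = ennreal (1 / q) * ((\<integral>\<^sup>+x. ennreal 1 * indicator {-pi..pi} x \<partial>lebesgue) + var_modular p (\<lambda>x. g x / a))"
    unfolding var_modular_def by (subst nn_integral_cmult, measurable) (subst nn_integral_add, auto)
  also have "\<dots> \<le> ennreal (1 / q) * (ennreal (2 * pi) + 1)"
    using a(2) nn_integral_period_const[of 1] by (intro mult_left_mono add_mono) auto
  also have "ennreal (1 / q) * (ennreal (2 * pi) + 1) = 1"
  proof -
    have "ennreal (2 * pi) + 1 = ennreal q" by (simp add: q_def flip: ennreal_1)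
    then show ?thesis using q by (simp flip: ennreal_mult')
  qed
  finally show ?thesis by (simp add: q_def)
qed

text \<open>The same comparison with \<open>s x\<close> below the constant \<open>s1\<close>. Here
  \<open>q * E\<close> itself is admissible in the infimum, so no further factor arises.
  Measurability is asked of \<open>u\<close> cut off to the period, the form in which integrability
  supplies it.\<close>

lemma var_norm_le_of_upper_power:
  assumes meas: "(\<lambda>x. indicator {-pi..pi} x * u x) \<in> borel_measurable lebesgue" and E: "E > 0"
    and s: "\<And>x. 1 \<le> s x" "AE x in lebesgue. s x \<le> s1"
    and u: "(\<integral>\<^sup>+x. ennreal (\<bar>u x\<bar> powr s1) * indicator {-pi..pi} x \<partial>lebesgue) \<le> ennreal (E powr s1)"
  shows "var_norm s u \<le> ennreal ((2 * pi + 1) * E)"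
proof -
  define q where "q = 2 * pi + 1"
  have q: "q > 1" by (simp add: q_def)
  have [measurable]: "{-pi..pi} \<in> sets lebesgue" by simp
  have [measurable]: "(\<lambda>x. ennreal (\<bar>u x\<bar> powr s1) * indicator {-pi..pi} x) \<in> borel_measurable lebesgue"
  proof -
    have "(\<lambda>x. ennreal (\<bar>indicator {-pi..pi} x * u x\<bar> powr s1) * indicator {-pi..pi} x) \<in> borel_measurable lebesgue"
      using meas by measurable
    moreover have "(\<lambda>x. ennreal (\<bar>indicator {-pi..pi} x * u x\<bar> powr s1) * indicator {-pi..pi} x)
        = (\<lambda>x. ennreal (\<bar>u x\<bar> powr s1) * indicator {-pi..pi} x)"
      by (auto simp: indicator_def)
    ultimately show ?thesis by simp
  qed
  have "var_modular s (\<lambda>x. u x / (q * E))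
      \<le> (\<integral>\<^sup>+x. ennreal (1 / q) * (ennreal 1 * indicator {-pi..pi} x
            + ennreal (1 / E powr s1) * (ennreal (\<bar>u x\<bar> powr s1) * indicator {-pi..pi} x)) \<partial>lebesgue)"
    unfolding var_modular_def
  proof (rule nn_integral_mono_AE)
    show "AE x in lebesgue. ennreal (\<bar>u x / (q * E)\<bar> powr s x) * indicator {-pi..pi} x
      \<le> ennreal (1 / q) * (ennreal 1 * indicator {-pi..pi} x
            + ennreal (1 / E powr s1) * (ennreal (\<bar>u x\<bar> powr s1) * indicator {-pi..pi} x))"
      using s(2)
    proof eventually_elim
      case (elim x)
      define t where "t = \<bar>u x\<bar> / E"
      have t: "t \<ge> 0" using E by (simp add: t_def)
      have "\<bar>u x / (q * E)\<bar> powr s x = (t / q) powr s x"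
        using q E by (simp add: t_def abs_mult mult.commute)
      also have "\<dots> = t powr s x / q powr s x" using t q by (simp add: powr_divide)
      also have "\<dots> \<le> t powr s x / q"
        using powr_mono[of 1 "s x" q] s(1)[of x] q by (intro divide_left_mono) auto
      also have "t powr s x \<le> 1 + t powr s1"
      proof (cases "t \<le> 1")
        case True
        then have "t powr s x \<le> 1 powr s x" using s(1)[of x] t by (intro powr_mono2) auto
        then have "t powr s x \<le> 1" by simp
        then show ?thesis using powr_ge_zero[of t s1] by linarith
      next
        case False
        then have "t powr s x \<le> t powr s1" using elim by (intro powr_mono) auto
        then show ?thesis by simp
      qed
      also have "t powr s1 = 1 / E powr s1 * \<bar>u x\<bar> powr s1"
        using E by (simp add: t_def powr_divide)
      finally have "\<bar>u x / (q * E)\<bar> powr s x \<le> 1 / q * (1 + 1 / E powr s1 * \<bar>u x\<bar> powr s1)"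
        using q by (simp add: divide_right_mono)
      then have "ennreal (\<bar>u x / (q * E)\<bar> powr s x) \<le> ennreal (1 / q * (1 + 1 / E powr s1 * \<bar>u x\<bar> powr s1))"
        by (rule ennreal_leI)
      also have "\<dots> = ennreal (1 / q) * (ennreal 1 + ennreal (1 / E powr s1) * ennreal (\<bar>u x\<bar> powr s1))"
        using q by (simp only: ennreal_mult ennreal_plus powr_ge_zero zero_le_one
            divide_nonneg_nonneg mult_nonneg_nonneg add_nonneg_nonneg less_imp_le)
      finally show ?case by (simp add: indicator_def)
    qed
  qed
  also have "\<dots> = ennreal (1 / q) * ((\<integral>\<^sup>+x. ennreal 1 * indicator {-pi..pi} x \<partial>lebesgue)
      + ennreal (1 / E powr s1) * (\<integral>\<^sup>+x. ennreal (\<bar>u x\<bar> powr s1) * indicator {-pi..pi} x \<partial>lebesgue))"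
    by (subst nn_integral_cmult, measurable) (subst nn_integral_add, auto simp: nn_integral_cmult)
  also have "\<dots> \<le> ennreal (1 / q) * (ennreal (2 * pi) + ennreal (1 / E powr s1) * ennreal (E powr s1))"
    using u nn_integral_period_const[of 1] by (intro mult_left_mono add_mono) auto
  also have "ennreal (1 / E powr s1) * ennreal (E powr s1) = 1"
    using E by (simp flip: ennreal_mult')
  also have "ennreal (1 / q) * (ennreal (2 * pi) + 1) = 1"
  proof -
    have "ennreal (2 * pi) + 1 = ennreal q" by (simp add: q_def flip: ennreal_1)
    then show ?thesis using q by (simp flip: ennreal_mult')
  qed
  finally have "var_modular s (\<lambda>x. u x / (q * E)) \<le> 1" .
  moreover have "q * E > 0" using q E by simp
  ultimately show ?thesis
    unfolding var_norm_def q_def[symmetric] by (intro INF_lower2[of "q * E"]) auto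
qed

text \<open>Removes the factors \<open>cos (\<beta> * pi / 2)\<close> and
  \<open>sin (\<beta> * pi / 2)\<close>: they cannot both be small, so the two conditions add up to
  one on the bare multiplier, with \<open>2 * C\<close>. Finiteness of \<open>nu \<psi> n\<close>
  comes from the strict bound by \<open>K\<close>, as \<open>C\<close> and
  \<open>n powr \<alpha>\<close> are positive.\<close>

lemma Upsilon_bounds:
  assumes "(\<psi>, \<beta>) \<in> Upsilon \<alpha>"
  obtains C :: real and v where "C > 0" "\<And>n. n \<ge> 1 \<Longrightarrow> nu \<psi> n = ennreal (v n)" "\<And>n. v n \<ge> 0"
    "\<And>n k. n \<ge> 1 \<Longrightarrow> k \<ge> 1 \<Longrightarrow> \<bar>real k powr \<alpha> * (if k < n then \<psi> n else \<psi> k)\<bar> \<le> C * (v n * real n powr \<alpha>)"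
    "\<And>n j. n \<ge> 1 \<Longrightarrow> j \<ge> 1 \<Longrightarrow> (\<Sum>k\<in>{2 ^ j..2 ^ (j + 1)}. \<bar>real (k + 1) powr \<alpha> * (if k + 1 < n then \<psi> n else \<psi> (k + 1))
        - real k powr \<alpha> * (if k < n then \<psi> n else \<psi> k)\<bar>) \<le> C * (v n * real n powr \<alpha>)"
proof -
  obtain C K where C: "C > 0" and U: "\<And>n. n \<ge> 1 \<Longrightarrow>
           seq_sup (mu \<psi> \<beta> n \<alpha>) \<le> ennreal C * nu \<psi> n * ennreal (real n powr \<alpha>) \<and>
           dyadic_variation (mu \<psi> \<beta> n \<alpha>) \<le> ennreal C * nu \<psi> n * ennreal (real n powr \<alpha>) \<and>
           seq_sup (mu_tilde \<psi> \<beta> n \<alpha>) \<le> ennreal C * nu \<psi> n * ennreal (real n powr \<alpha>) \<and>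
           dyadic_variation (mu_tilde \<psi> \<beta> n \<alpha>) \<le> ennreal C * nu \<psi> n * ennreal (real n powr \<alpha>) \<and>
           ennreal C * nu \<psi> n * ennreal (real n powr \<alpha>) < ennreal K"
    using assms by (auto simp: Upsilon_def)
  define v where "v n = enn2real (nu \<psi> n)" for n
  have v: "nu \<psi> n = ennreal (v n)" if "n \<ge> 1" for n
  proof -
    have "nu \<psi> n \<noteq> \<infinity>"
    proof
      assume "nu \<psi> n = \<infinity>"
      then have "ennreal C * nu \<psi> n * ennreal (real n powr \<alpha>) = \<infinity>"
        using C that by (simp add: ennreal_mult_top ennreal_top_mult ennreal_mult_eq_top_iff)
      then show False using U[OF that] by simp
    qed
    then show ?thesis by (simp add: v_def ennreal_enn2real less_top)
  qed
  have v0: "v n \<ge> 0" for n by (simp add: v_def)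
  \<comment> \<open>From \<open>1 = cos^2 + sin^2\<close> and values of modulus at most
    \<open>1\<close>.\<close>
  have split: "\<bar>z\<bar> \<le> \<bar>z * cos \<theta>\<bar> + \<bar>z * sin \<theta>\<bar>" for z \<theta> :: real
  proof -
    have "cos \<theta> * cos \<theta> \<le> \<bar>cos \<theta>\<bar>" "sin \<theta> * sin \<theta> \<le> \<bar>sin \<theta>\<bar>"
      using mult_left_le[of "\<bar>cos \<theta>\<bar>" "\<bar>cos \<theta>\<bar>"] mult_left_le[of "\<bar>sin \<theta>\<bar>" "\<bar>sin \<theta>\<bar>"]
      by (auto simp flip: abs_mult)
    then have "1 \<le> \<bar>cos \<theta>\<bar> + \<bar>sin \<theta>\<bar>"
      using sin_cos_squared_add3[of \<theta>] by linarith
    then have "\<bar>z\<bar> * 1 \<le> \<bar>z\<bar> * (\<bar>cos \<theta>\<bar> + \<bar>sin \<theta>\<bar>)" by (intro mult_left_mono) auto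
    then show ?thesis by (simp add: abs_mult distrib_left)
  qed
  define l where "l n k = real k powr \<alpha> * (if k < n then \<psi> n else \<psi> k)" for n k
  have mu: "mu \<psi> \<beta> n \<alpha> k = l n k * cos (\<beta> * pi / 2)" "mu_tilde \<psi> \<beta> n \<alpha> k = l n k * sin (\<beta> * pi / 2)" for n k
    by (simp_all add: mu_def mu_tilde_def l_def)
  have R: "ennreal C * nu \<psi> n * ennreal (real n powr \<alpha>) = ennreal (C * (v n * real n powr \<alpha>))" if "n \<ge> 1" for n
    using C v0 v[OF that] by (simp add: ennreal_mult mult.assoc)
  have R0: "C * (v n * real n powr \<alpha>) \<ge> 0" for n using C v0 by simp
  have sup: "\<bar>w k\<bar> \<le> C * (v n * real n powr \<alpha>)"
    if "n \<ge> 1" "k \<ge> 1" "seq_sup w \<le> ennreal C * nu \<psi> n * ennreal (real n powr \<alpha>)" for w n k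
  proof -
    have "ennreal \<bar>w k\<bar> \<le> seq_sup w" unfolding seq_sup_def using that by (intro SUP_upper) auto
    then have "ennreal \<bar>w k\<bar> \<le> ennreal (C * (v n * real n powr \<alpha>))" using that R by simp
    then show ?thesis using R0 by simp
  qed
  have var: "(\<Sum>k\<in>{2 ^ j..2 ^ (j + 1)}. \<bar>w (k + 1) - w k\<bar>) \<le> C * (v n * real n powr \<alpha>)"
    if "n \<ge> 1" "j \<ge> 1" "dyadic_variation w \<le> ennreal C * nu \<psi> n * ennreal (real n powr \<alpha>)" for w n j
  proof -
    have "ennreal (\<Sum>k\<in>{2 ^ j..2 ^ (j + 1)}. \<bar>w (k + 1) - w k\<bar>) \<le> dyadic_variation w"
      unfolding dyadic_variation_def using that by (intro SUP_upper) auto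
    then have "ennreal (\<Sum>k\<in>{2 ^ j..2 ^ (j + 1)}. \<bar>w (k + 1) - w k\<bar>) \<le> ennreal (C * (v n * real n powr \<alpha>))"
      using that R by simp
    then show ?thesis using R0 by (simp only: ennreal_le_iff)
  qed
  show thesis
  proof (rule that[of "2 * C" v])
    show "2 * C > 0" using C by simp
    show "\<bar>real k powr \<alpha> * (if k < n then \<psi> n else \<psi> k)\<bar> \<le> 2 * C * (v n * real n powr \<alpha>)"
      if "n \<ge> 1" "k \<ge> 1" for n k
      using sup[OF that, of "mu \<psi> \<beta> n \<alpha>"] sup[OF that, of "mu_tilde \<psi> \<beta> n \<alpha>"] U[OF that(1)]
        split[of "l n k" "\<beta> * pi / 2"]
      unfolding mu l_def[symmetric] by linarith
    show "(\<Sum>k\<in>{2 ^ j..2 ^ (j + 1)}. \<bar>real (k + 1) powr \<alpha> * (if k + 1 < n then \<psi> n else \<psi> (k + 1))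
        - real k powr \<alpha> * (if k < n then \<psi> n else \<psi> k)\<bar>) \<le> 2 * C * (v n * real n powr \<alpha>)"
      if "n \<ge> 1" "j \<ge> 1" for n j
    proof -
      have "(\<Sum>k\<in>{2 ^ j..2 ^ (j + 1)}. \<bar>l n (k + 1) - l n k\<bar>)
          \<le> (\<Sum>k\<in>{2 ^ j..2 ^ (j + 1)}. \<bar>mu \<psi> \<beta> n \<alpha> (k + 1) - mu \<psi> \<beta> n \<alpha> k\<bar> + \<bar>mu_tilde \<psi> \<beta> n \<alpha> (k + 1) - mu_tilde \<psi> \<beta> n \<alpha> k\<bar>)"
        unfolding mu left_diff_distrib[symmetric] by (intro sum_mono split)
      then show ?thesis
        using var[OF that, of "mu \<psi> \<beta> n \<alpha>"] var[OF that, of "mu_tilde \<psi> \<beta> n \<alpha>"] U[OF that(1)]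
        unfolding l_def[symmetric] sum.distrib by linarith
    qed
  qed (use v v0 in auto)
qed

section \<open>Reduction to constant exponents and the rate of approximation\<close>

theorem theorem2:
  fixes \<gamma> \<alpha> \<beta> :: real and p s :: "real \<Rightarrow> real" and \<psi> :: "nat \<Rightarrow> real"
  assumes "\<gamma> \<ge> 1"
    and "p \<in> DL_exponents \<gamma>" and "s \<in> DL_exponents \<gamma>"
    and "\<forall>x\<in>{0..2 * pi}. p x < s x"
    and "\<alpha> = 1 / exp_lower p - 1 / exp_upper s"
    and "\<forall>k\<ge>1. \<psi> k \<noteq> 0"
    and "(\<psi>, \<beta>) \<in> Upsilon \<alpha>"
  shows "\<exists>C::real. C > 0 \<and>
           (\<forall>n\<ge>1. approx_error \<psi> \<beta> p n s \<le> ennreal (C * real n powr \<alpha>) * nu \<psi> n)"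
proof -
  define p0 where "p0 = exp_lower p"
  define s1 where "s1 = exp_upper s"
  define r where "r = s1 / (s1 - 1)"
  have p0: "p0 > 1" "AE x in lebesgue. p0 \<le> p x" and s1: "AE x in lebesgue. s x \<le> s1"
    using DL_exponents_bounds[of p \<gamma>] DL_exponents_bounds[of s \<gamma>] assms(1-3) by (auto simp: p0_def s1_def)
  have meas: "p \<in> borel_measurable lebesgue" and s_ge: "\<And>x. 1 \<le> s x"
    using assms(2,3) by (auto simp: DL_exponents_def exponent_def less_imp_le)
  \<comment> \<open>Essential bounds are compared at one point where both hold, so that the strict
    pointwise inequality is inherited.\<close>
  have "p0 < s1"
  proof -
    obtain x where "x \<in> {0..2 * pi}" "p0 \<le> p x" "s x \<le> s1"
      using lebesgue_AE_exists[of "\<lambda>x. p0 \<le> p x \<and> s x \<le> s1" 0 "2 * pi"] p0 s1 by auto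
    then show ?thesis using assms(4) by force
  qed
  then have "s1 > 1" using p0 by simp
  then have r: "r > 1" "1 / r + 1 / s1 = 1" by (auto simp: r_def field_simps)
  have \<alpha>: "\<alpha> = 1 / p0 - 1 / s1" using assms(5) by (simp add: p0_def s1_def)
  have \<alpha>0: "0 < \<alpha>" using \<open>p0 < s1\<close> p0 by (simp add: \<alpha> frac_less2)
  have \<alpha>1: "\<alpha> < 1"
  proof -
    have "1 / p0 < 1" "1 / s1 > 0" using p0 \<open>s1 > 1\<close> by auto
    then show ?thesis unfolding \<alpha> by linarith
  qed
  have pr: "1 / p0 + 1 / r = 1 + \<alpha>" using r(2) unfolding \<alpha> by linarith
  obtain Cm where Cm: "Cm > 0" and bilin: "\<And>l m M g \<tau> N \<theta>. (\<And>k. k \<ge> 1 \<Longrightarrow> \<bar>l k\<bar> \<le> M) \<Longrightarrow>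
      (\<And>j. j \<ge> 1 \<Longrightarrow> (\<Sum>k\<in>{2 ^ j..2 ^ (j + 1)}. \<bar>l (k + 1) - l k\<bar>) \<le> M) \<Longrightarrow>
      (\<And>k::nat. k \<ge> 1 \<Longrightarrow> m k = real k powr (- \<alpha>) * l k) \<Longrightarrow>
      g \<in> borel_measurable lebesgue \<Longrightarrow> \<tau> \<in> borel_measurable borel \<Longrightarrow>
      (\<integral>\<^sup>+y. ennreal (\<bar>g y\<bar> powr p0) * indicator {-pi..pi} y \<partial>lebesgue) \<le> 1 \<Longrightarrow>
      (\<integral>\<^sup>+x. ennreal (\<bar>\<tau> x\<bar> powr r) * indicator {-pi..pi} x \<partial>lebesgue) \<le> 1 \<Longrightarrow>
      (\<integral>\<^sup>+x. \<integral>\<^sup>+y. ennreal (\<bar>\<tau> x\<bar> * \<bar>g y\<bar> * \<bar>\<Sum>k\<in>{1..N}. m k * cos (real k * (x - y) - \<theta>)\<bar>)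
          * indicator ({-pi..pi} \<times> {-pi..pi}) (x, y) \<partial>lebesgue \<partial>lebesgue) \<le> ennreal (Cm * M)"
    by (fact multiplier_bilinear_bound[OF \<alpha>0 \<alpha>1 p0(1) r(1) pr])
  obtain Cu v where Cu: "Cu > 0" and nu: "\<And>n. n \<ge> 1 \<Longrightarrow> nu \<psi> n = ennreal (v n)" and v0: "\<And>n. v n \<ge> 0"
    and lbd: "\<And>n k. n \<ge> 1 \<Longrightarrow> k \<ge> 1 \<Longrightarrow> \<bar>real k powr \<alpha> * (if k < n then \<psi> n else \<psi> k)\<bar> \<le> Cu * (v n * real n powr \<alpha>)"
    and lvar: "\<And>n j. n \<ge> 1 \<Longrightarrow> j \<ge> 1 \<Longrightarrow> (\<Sum>k\<in>{2 ^ j..2 ^ (j + 1)}. \<bar>real (k + 1) powr \<alpha> * (if k + 1 < n then \<psi> n else \<psi> (k + 1))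
        - real k powr \<alpha> * (if k < n then \<psi> n else \<psi> k)\<bar>) \<le> Cu * (v n * real n powr \<alpha>)"
    by (fact Upsilon_bounds[OF assms(7)])
  define q where "q = 2 * pi + 1"
  have q: "q > 1" by (simp add: q_def)
  \<comment> \<open>Outer \<open>q\<close>: from constant exponent \<open>s1\<close> to
    \<open>s\<close>. Next \<open>2\<close>: duality. Then \<open>2 * q\<close>: normalisation of
    \<open>g\<close> in the constant exponent \<open>p0\<close>, and \<open>1 / pi\<close>: the
    Fourier coefficients.\<close>
  define C where "C = q * (2 * (2 * q / pi * (Cm * Cu)))"
  have "C > 0" using q Cm Cu by (simp add: C_def)
  moreover have "approx_error \<psi> \<beta> p n s \<le> ennreal (C * real n powr \<alpha>) * nu \<psi> n" if n: "n \<ge> 1" for n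
    unfolding approx_error_def
  proof (rule SUP_least)
    fix f assume "f \<in> L_psi_beta_p \<psi> \<beta> p"
    then obtain g where f: "f \<in> Lper" and d: "is_psi_beta_deriv \<psi> \<beta> f g"
      and g: "g \<in> Lvar p" "var_norm p g \<le> 1"
      by (auto simp: L_psi_beta_p_def L_psi_beta_def)
    have gm[measurable]: "g \<in> borel_measurable lebesgue" using g by (simp add: Lvar_def)
    define M where "M = Cu * (v n * real n powr \<alpha>)"
    \<comment> \<open>Duality requires \<open>D > 0\<close>; since \<open>\<psi>\<close> has no
      zeros, the bound on the multiplier at \<open>k = 1\<close> is already positive.\<close>
    have M: "M > 0"
    proof -
      have "0 < \<bar>real 1 powr \<alpha> * (if 1 < n then \<psi> n else \<psi> 1)\<bar>" using assms(6) n by auto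
      then show ?thesis using lbd[OF n, of 1] unfolding M_def by linarith
    qed
    define D where "D = 2 * q / pi * (Cm * M)"
    have D: "D > 0" using q Cm M by (simp add: D_def)
    define u where "u x = f x - Zhat \<psi> n f x" for x
    have Zc: "continuous_on {-pi..pi} (Zhat \<psi> n f)"
      unfolding Zhat_def[abs_def] by (intro continuous_intros)
    have u: "set_integrable lebesgue {-pi..pi} u"
      unfolding u_def using f
      by (intro set_integral_diff(1) absolutely_integrable_continuous_real[OF Zc]) (simp add: Lper_def)
    have dual: "(LINT x:{-pi..pi}|lebesgue. u x * \<tau> x) \<le> D"
      if \<tau>: "trig_poly \<tau>" and \<tau>r: "(\<integral>\<^sup>+x. ennreal (\<bar>\<tau> x\<bar> powr r) * indicator {-pi..pi} x \<partial>lebesgue) \<le> 1" for \<tau>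
    proof -
      obtain L where L: "\<And>N. N \<ge> L \<Longrightarrow> (LINT x:{-pi..pi}|lebesgue. (f x - (\<Sum>k\<le>N. fourier_A k f x)) * \<tau> x) = 0"
        using fourier_partial_sum_test[OF f \<tau>] by blast
      \<comment> \<open>\<open>L\<close> makes the partial sum exact against \<open>\<tau>\<close>;
        \<open>n\<close> is needed for the formula of the remainder.\<close>
      define N where "N = max L n"
      define m where "m k = (if k < n then \<psi> n else \<psi> k)" for k
      \<comment> \<open>The normalised function is \<open>g / (2 * q)\<close>; the compensating
        factor and the \<open>1 / pi\<close> of the convolution are moved into the multiplier, which
        replaces \<open>M\<close> by \<open>c * M\<close>.\<close>
      define c where "c = 2 * q / pi"
      have c: "c > 0" using q by (simp add: c_def)
      define K where "K t = (\<Sum>k\<in>{1..N}. c * m k * cos (real k * t - \<beta> * pi / 2))" for t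
      \<comment> \<open>\<open>u\<close> and \<open>Q\<close> differ by \<open>f\<close> minus its
        partial sum, which \<open>\<tau>\<close> does not see; \<open>Q\<close> is continuous and
        has a kernel representation.\<close>
      define Q where "Q x = (\<Sum>k\<le>N. fourier_A k f x) - Zhat \<psi> n f x" for x
      have Q: "Q x = (LINT y:{-pi..pi}|lebesgue. g y / (2 * q) * K (x - y))" for x
      proof -
        have "K (x - y) = c * (\<Sum>k\<in>{1..N}. m k * cos (real k * (x - y) - \<beta> * pi / 2))" for y
          by (simp add: K_def sum_distrib_left mult.assoc)
        then have pt: "1 / pi * (g y * (\<Sum>k\<in>{1..N}. m k * cos (real k * (x - y) - \<beta> * pi / 2)))
            = g y / (2 * q) * K (x - y)" for y
          using q by (simp add: c_def)
        have "Q x = 1 / pi * (LINT y:{-pi..pi}|lebesgue. g y *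
            (\<Sum>k\<in>{1..N}. m k * cos (real k * (x - y) - \<beta> * pi / 2)))"
          unfolding Q_def m_def by (rule Zhat_remainder[OF d assms(6) n]) (simp add: N_def)
        also have "\<dots> = (LINT y:{-pi..pi}|lebesgue. 1 / pi * (g y *
            (\<Sum>k\<in>{1..N}. m k * cos (real k * (x - y) - \<beta> * pi / 2))))"
          by (rule set_integral_mult_right[symmetric])
        finally show ?thesis by (simp only: pt)
      qed
      have Qc: "continuous_on {-pi..pi} Q"
        unfolding Q_def[abs_def] by (intro continuous_intros Zc)
      have Kc: "continuous_on S (\<lambda>y. K (x - y))" for S x
        unfolding K_def by (intro continuous_intros)
      have Q\<tau>: "set_integrable lebesgue {-pi..pi} (\<lambda>x. Q x * \<tau> x)"
        by (intro absolutely_integrable_continuous_real continuous_intros Qc trig_poly_continuous \<tau>)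
      have gi: "set_integrable lebesgue {-pi..pi} g" using d by (simp add: is_psi_beta_deriv_def Lper_def)
      have "(LINT x:{-pi..pi}|lebesgue. u x * \<tau> x)
          = (LINT x:{-pi..pi}|lebesgue. Q x * \<tau> x + (f x - (\<Sum>k\<le>N. fourier_A k f x)) * \<tau> x)"
        by (simp add: u_def Q_def algebra_simps)
      also have "\<dots> = (LINT x:{-pi..pi}|lebesgue. Q x * \<tau> x)
          + (LINT x:{-pi..pi}|lebesgue. (f x - (\<Sum>k\<le>N. fourier_A k f x)) * \<tau> x)"
      proof (rule set_integral_add(2)[OF Q\<tau>])
        have "set_integrable lebesgue {-pi..pi} (\<lambda>x. f x - (\<Sum>k\<le>N. fourier_A k f x))"
          using f unfolding Lper_def
          by (intro set_integral_diff(1)) (auto intro!: absolutely_integrable_continuous_real continuous_intros)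
        then show "set_integrable lebesgue {-pi..pi} (\<lambda>x. (f x - (\<Sum>k\<le>N. fourier_A k f x)) * \<tau> x)"
          by (rule set_integrable_continuous_mult[OF _ trig_poly_continuous[OF \<tau>]])
      qed
      also have "\<dots> = (LINT x:{-pi..pi}|lebesgue. Q x * \<tau> x)"
        by (simp add: L N_def)
      finally have eq: "(LINT x:{-pi..pi}|lebesgue. u x * \<tau> x) = (LINT x:{-pi..pi}|lebesgue. Q x * \<tau> x)" .
      have Qle: "ennreal \<bar>Q x\<bar> \<le> (\<integral>\<^sup>+y. ennreal (\<bar>g y / (2 * q)\<bar> * \<bar>K (x - y)\<bar>) * indicator {-pi..pi} y \<partial>lebesgue)" for x
      proof -
        have "set_integrable lebesgue {-pi..pi} (\<lambda>y. g y / (2 * q) * K (x - y))"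
          by (intro set_integrable_continuous_mult Kc set_integrable_divide gi)
        then have "ennreal \<bar>Q x\<bar> \<le> (\<integral>\<^sup>+y. ennreal (norm (indicator {-pi..pi} y *\<^sub>R (g y / (2 * q) * K (x - y)))) \<partial>lebesgue)"
          unfolding Q set_lebesgue_integral_def real_norm_def[symmetric]
          by (intro integral_norm_bound_ennreal) (simp_all add: set_integrable_def)
        also have "\<dots> = (\<integral>\<^sup>+y. ennreal (\<bar>g y / (2 * q)\<bar> * \<bar>K (x - y)\<bar>) * indicator {-pi..pi} y \<partial>lebesgue)"
          by (intro nn_integral_cong) (auto simp: indicator_def abs_mult)
        finally show ?thesis .
      qed
      define I where "I = (\<integral>\<^sup>+x. \<integral>\<^sup>+y. ennreal (\<bar>\<tau> x\<bar> * \<bar>g y / (2 * q)\<bar> * \<bar>K (x - y)\<bar>)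
          * indicator ({-pi..pi} \<times> {-pi..pi}) (x, y) \<partial>lebesgue \<partial>lebesgue)"
      have I: "I \<le> ennreal (Cm * (c * M))"
        unfolding I_def K_def
      proof (rule bilin[where l = "\<lambda>k. c * (real k powr \<alpha> * m k)"])
        show "\<bar>c * (real k powr \<alpha> * m k)\<bar> \<le> c * M" if "k \<ge> 1" for k
          using lbd[OF n that] c unfolding abs_mult[of c] by (simp add: m_def M_def)
        show "(\<Sum>k\<in>{2 ^ j..2 ^ (j + 1)}. \<bar>c * (real (k + 1) powr \<alpha> * m (k + 1)) - c * (real k powr \<alpha> * m k)\<bar>) \<le> c * M"
          if "j \<ge> 1" for j
        proof -
          have "(\<Sum>k\<in>{2 ^ j..2 ^ (j + 1)}. \<bar>c * (real (k + 1) powr \<alpha> * m (k + 1)) - c * (real k powr \<alpha> * m k)\<bar>)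
             = c * (\<Sum>k\<in>{2 ^ j..2 ^ (j + 1)}. \<bar>real (k + 1) powr \<alpha> * m (k + 1) - real k powr \<alpha> * m k\<bar>)"
            unfolding sum_distrib_left right_diff_distrib[symmetric] abs_mult[of c] using c by simp
          also have "\<dots> \<le> c * M"
            using c lvar[OF n that] by (intro mult_left_mono) (simp_all only: m_def M_def less_imp_le)
          finally show ?thesis .
        qed
        show "c * m k = real k powr (- \<alpha>) * (c * (real k powr \<alpha> * m k))" if "k \<ge> 1" for k
          using that by (simp add: powr_minus)
        show "\<tau> \<in> borel_measurable borel"
          by (intro borel_measurable_continuous_onI trig_poly_continuous \<tau>)
        show "(\<integral>\<^sup>+y. ennreal (\<bar>g y / (2 * q)\<bar> powr p0) * indicator {-pi..pi} y \<partial>lebesgue) \<le> 1"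
          unfolding q_def using p0 by (intro var_norm_le_imp_lower_power[OF gm meas g(2)]) auto
      qed (use \<tau>r in auto)
      have "ennreal (LINT x:{-pi..pi}|lebesgue. Q x * \<tau> x) \<le> ennreal (norm (LINT x:{-pi..pi}|lebesgue. Q x * \<tau> x))"
        by (intro ennreal_leI) simp
      also have "\<dots> \<le> (\<integral>\<^sup>+x. ennreal (norm (indicator {-pi..pi} x *\<^sub>R (Q x * \<tau> x))) \<partial>lebesgue)"
        unfolding set_lebesgue_integral_def using Q\<tau>
        by (intro integral_norm_bound_ennreal) (simp add: set_integrable_def)
      also have "\<dots> \<le> I"
        unfolding I_def
      proof (rule nn_integral_mono)
        fix x
        have [measurable]: "(\<lambda>y. K (x - y)) \<in> borel_measurable lebesgue"
          using borel_measurable_continuous_onI[OF Kc[of UNIV x]] by (intro measurable_completion) simp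
        have [measurable]: "{-pi..pi} \<in> sets lebesgue" by simp
        have "(\<integral>\<^sup>+y. ennreal \<bar>\<tau> x\<bar> * (ennreal (\<bar>g y / (2 * q)\<bar> * \<bar>K (x - y)\<bar>) * indicator {-pi..pi} y) \<partial>lebesgue)
            = ennreal \<bar>\<tau> x\<bar> * (\<integral>\<^sup>+y. ennreal (\<bar>g y / (2 * q)\<bar> * \<bar>K (x - y)\<bar>) * indicator {-pi..pi} y \<partial>lebesgue)"
          by (intro nn_integral_cmult) measurable
        moreover have "ennreal (norm (indicator {-pi..pi} x *\<^sub>R (Q x * \<tau> x))) = indicator {-pi..pi} x * (ennreal \<bar>\<tau> x\<bar> * ennreal \<bar>Q x\<bar>)"
          by (auto simp: indicator_def abs_mult ennreal_mult mult.commute)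
        moreover have "indicator {-pi..pi} x * (ennreal \<bar>\<tau> x\<bar> * ennreal \<bar>Q x\<bar>) \<le> indicator {-pi..pi} x * (ennreal \<bar>\<tau> x\<bar> *
            (\<integral>\<^sup>+y. ennreal (\<bar>g y / (2 * q)\<bar> * \<bar>K (x - y)\<bar>) * indicator {-pi..pi} y \<partial>lebesgue))"
          by (intro mult_left_mono Qle) auto
        ultimately have "ennreal (norm (indicator {-pi..pi} x *\<^sub>R (Q x * \<tau> x)))
            \<le> indicator {-pi..pi} x * (\<integral>\<^sup>+y. ennreal \<bar>\<tau> x\<bar> * (ennreal (\<bar>g y / (2 * q)\<bar> * \<bar>K (x - y)\<bar>) * indicator {-pi..pi} y) \<partial>lebesgue)"
          by simp
        also have "\<dots> = (\<integral>\<^sup>+y. ennreal (\<bar>\<tau> x\<bar> * \<bar>g y / (2 * q)\<bar> * \<bar>K (x - y)\<bar>)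
          * indicator ({-pi..pi} \<times> {-pi..pi}) (x, y) \<partial>lebesgue)"
        proof (cases "x \<in> {-pi..pi}")
          case True
          then show ?thesis
            by (simp, intro nn_integral_cong) (auto simp: indicator_def mult.assoc simp flip: ennreal_mult')
        qed (simp add: indicator_times)
        finally show "ennreal (norm (indicator {-pi..pi} x *\<^sub>R (Q x * \<tau> x)))
            \<le> (\<integral>\<^sup>+y. ennreal (\<bar>\<tau> x\<bar> * \<bar>g y / (2 * q)\<bar> * \<bar>K (x - y)\<bar>)
          * indicator ({-pi..pi} \<times> {-pi..pi}) (x, y) \<partial>lebesgue)" .
      qed
      also have "\<dots> \<le> ennreal D" using I by (simp add: D_def c_def mult.left_commute)
      finally show ?thesis using D by (simp add: eq)
    qed
    have "(\<integral>\<^sup>+x. ennreal (\<bar>u x\<bar> powr s1) * indicator {-pi..pi} x \<partial>lebesgue) \<le> ennreal ((2 * D) powr s1)"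
      by (rule trig_poly_dual_bound[OF u D r dual])
    then have "var_norm s u \<le> ennreal (q * (2 * D))"
      unfolding q_def using D s_ge s1 u
      by (intro var_norm_le_of_upper_power) (auto simp: set_integrable_def)
    also have "q * (2 * D) = C * real n powr \<alpha> * v n"
      by (simp add: C_def D_def M_def)
    also have "ennreal \<dots> = ennreal (C * real n powr \<alpha>) * nu \<psi> n"
      using v0 \<open>C > 0\<close> by (simp add: nu[OF n] ennreal_mult)
    finally show "var_norm s (\<lambda>x. f x - Zhat \<psi> n f x) \<le> ennreal (C * real n powr \<alpha>) * nu \<psi> n"
      by (simp add: u_def[abs_def])
  qed
  ultimately show ?thesis by blast
qed

end
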